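(* Let $I$ be an interval with $\inf I=0$, let $\mathscr{M}$ be a symmetric, monotone and Jensen concave $\mathbb{R}$-weighted mean on $I$ which is continuous in the weights, and let $\lambda\in V(\mathbb{R})$. Define $$\mathscr{C}_\lambda(\mathscr{M}):=\sup_{y>0}\ \liminf_{n\to\infty}\ \frac{\lambda_1+\cdots+\lambda_n}{y}\cdot\mathscr{M}\Big(\Big(\tfrac{y}{\lambda_1},\tfrac{y}{\lambda_1+\lambda_2},\dots,\tfrac{y}{\lambda_1+\cdots+\lambda_n}\Big),(\lambda_1,\dots,\lambda_n)\Big).$$ Then $\mathscr{H}_\lambda(\mathscr{M})\le\mathscr{C}_\lambda(\mathscr{M})$. Furthermore, if $\sum_{n=1}^\infty\lambda_n=\infty$, then $\mathscr{H}_\lambda(\mathscr{M})=\mathscr{C}_\lambda(\mathscr{M})$.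
   Context: For an interval $I\subseteq\mathbb{R}$ and a ring $R\subseteq\mathbb{R}$ (here $R=\mathbb{R}$), let $W_n(R)=\{(\lambda_1,\dots,\lambda_n)\in R^n:\lambda_1,\dots,\lambda_n\ge0,\ \lambda_1+\cdots+\lambda_n>0\}$. An $R$-weighted mean on $I$ is a function $\mathscr{M}:\bigcup_{n\ge1}I^n\times W_n(R)\to I$ such that for all $n$: (1) nullhomogeneity in the weights: $\mathscr{M}(x,\lambda)=\mathscr{M}(x,t\lambda)$ for all $x\in I^n$, $\lambda\in W_n(R)$ and $t\in R$, $t>0$; (2) reduction principle: $\mathscr{M}(x,\lambda+\mu)=\mathscr{M}(x\odot x,\lambda\odot\mu)$ for all $x\in I^n$, $\lambda,\mu\in W_n(R)$, where $(p_1,\dots,p_n)\odot(q_1,\dots,q_n):=(p_1,q_1,\dots,p_n,q_n)$; (3) mean value property: $\min_i x_i\le\mathscr{M}(x,\lambda)\le\max_i x_i$ for all $x\in I^n$, $\lambda\in W_n(R)$; (4) elimination principle: if $\lambda_j=0$, then $\mathscr{M}(x,\lambda)$ is unchanged when the $j$-th entry of both $x$ and $\lambda$ is deleted. $\mathscr{M}$ is symmetric if $\mathscr{M}(x,\lambda)=\mathscr{M}(x\circ\sigma,\lambda\circ\sigma)$ for all $n$, $x\in I^n$, $\lambda\in W_n(R)$ and permutations $\sigma\in S_n$. It is monotone if $\mathscr{M}(x,\lambda)$ is nondecreasing in each variable $x_i$. It is Jensen concave if $\mathscr{M}(\frac{x+y}2,\lambda)\ge\frac12(\mathscr{M}(x,\lambda)+\mathscr{M}(y,\lambda))$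 for all $n$, $x,y\in I^n$, $\lambda\in W_n(R)$. It is continuous in the weights if, for all $n$ and $x\in I^n$, the map $\lambda\mapsto\mathscr{M}(x,\lambda)$ is continuous on $W_n(R)$. $V(R)$ is the set of sequences $\lambda=(\lambda_n)_{n=1}^\infty$ in $R$ with $\lambda_1>0$, $\lambda_n\ge0$ for all $n\ge2$, and such that the sequence $\big(\frac{\lambda_n}{\lambda_1+\cdots+\lambda_n}\big)_{n=1}^\infty$ is nonincreasing. For a sequence $\lambda$ in $R$ with $\lambda_1>0$ and $\lambda_n\ge0$ for $n\ge2$, the $\lambda$-Hardy constant $\mathscr{H}_\lambda(\mathscr{M})$ is the smallest extended real number $C$ such that $\sum_{n=1}^\infty\lambda_n\,\mathscr{M}((x_1,\dots,x_n),(\lambda_1,\dots,\lambda_n))\le C\sum_{n=1}^\infty\lambda_nx_n$ for all sequences $(x_n)$ in $I$. *)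

theory Defs
  imports "HOL-Analysis.Analysis" "HOL-Combinatorics.Permutations"
begin

definition weights :: "nat \<Rightarrow> real list set" where
  "weights n = {w. length w = n \<and> (\<forall>t\<in>set w. 0 \<le> t) \<and> 0 < sum_list w}"

definition points :: "real set \<Rightarrow> nat \<Rightarrow> real list set" where
  "points I n = {x. length x = n \<and> set x \<subseteq> I}"

definition delete_nth :: "nat \<Rightarrow> 'a list \<Rightarrow> 'a list" where
  "delete_nth j xs = take j xs @ drop (Suc j) xs"

(* A mean is a function on pairs of lists; its values matter only on the pairs in
   points I n \<times> weights n with n \<ge> 1.  (For n = 0 there are no such pairs, since
   weights 0 is empty.)  On lists of equal length, splice is the interleaving
   (p_1, q_1, ..., p_n, q_n). *)
definition weighted_mean :: "real set \<Rightarrow> (real list \<Rightarrow> real list \<Rightarrow> real) \<Rightarrow> bool" where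
  "weighted_mean I M \<longleftrightarrow>
    (\<forall>n. \<forall>x\<in>points I n. \<forall>w\<in>weights n. M x w \<in> I) \<and>
    (\<forall>n. \<forall>x\<in>points I n. \<forall>w\<in>weights n. \<forall>t>0. M x w = M x (map (\<lambda>s. t * s) w)) \<and>
    (\<forall>n. \<forall>x\<in>points I n. \<forall>v\<in>weights n. \<forall>w\<in>weights n.
       M x (map2 (+) v w) = M (splice x x) (splice v w)) \<and>
    (\<forall>n. \<forall>x\<in>points I n. \<forall>w\<in>weights n. Min (set x) \<le> M x w \<and> M x w \<le> Max (set x)) \<and>
    (\<forall>n. \<forall>x\<in>points I n. \<forall>w\<in>weights n. \<forall>j<n. w ! j = 0 \<longrightarrow>
       M x w = M (delete_nth j x) (delete_nth j w))"

definition symmetric_mean :: "real set \<Rightarrow> (real list \<Rightarrow> real list \<Rightarrow> real) \<Rightarrow> bool" where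
  "symmetric_mean I M \<longleftrightarrow>
    (\<forall>n. \<forall>x\<in>points I n. \<forall>w\<in>weights n. \<forall>\<sigma>. \<sigma> permutes {..<n} \<longrightarrow>
       M x w = M (permute_list \<sigma> x) (permute_list \<sigma> w))"

definition monotone_mean :: "real set \<Rightarrow> (real list \<Rightarrow> real list \<Rightarrow> real) \<Rightarrow> bool" where
  "monotone_mean I M \<longleftrightarrow>
    (\<forall>n. \<forall>x\<in>points I n. \<forall>w\<in>weights n. \<forall>i<n. \<forall>t\<in>I. x ! i \<le> t \<longrightarrow> M x w \<le> M (x[i := t]) w)"

definition jensen_concave_mean :: "real set \<Rightarrow> (real list \<Rightarrow> real list \<Rightarrow> real) \<Rightarrow> bool" where
  "jensen_concave_mean I M \<longleftrightarrow>
    (\<forall>n. \<forall>x\<in>points I n. \<forall>y\<in>points I n. \<forall>w\<in>weights n.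
       M (map2 (\<lambda>a b. (a + b) / 2) x y) w \<ge> (M x w + M y w) / 2)"

(* Euclidean_space n is the library's R^n, whose points are functions nat => real
   vanishing from n on; map v [0..<n] is the list of the coordinates of v. *)
definition continuous_in_weights :: "real set \<Rightarrow> (real list \<Rightarrow> real list \<Rightarrow> real) \<Rightarrow> bool" where
  "continuous_in_weights I M \<longleftrightarrow>
    (\<forall>n. \<forall>x\<in>points I n.
       continuous_map (subtopology (Euclidean_space n) {v. map v [0..<n] \<in> weights n})
         euclideanreal (\<lambda>v. M x (map v [0..<n])))"

(* Sequences are indexed from 0: the term with mathematical index n + 1 is l n.
   Hence psum l n and upto_term x n belong to the first n + 1 terms. *)
definition psum :: "(nat \<Rightarrow> real) \<Rightarrow> nat \<Rightarrow> real" where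
  "psum l n = (\<Sum>i\<le>n. l i)"

definition upto_term :: "(nat \<Rightarrow> real) \<Rightarrow> nat \<Rightarrow> real list" where
  "upto_term x n = map x [0..<Suc n]"

definition V_weights :: "(nat \<Rightarrow> real) set" where
  "V_weights = {l. 0 < l 0 \<and> (\<forall>n. 0 \<le> l n) \<and> decseq (\<lambda>n. l n / psum l n)}"

(* Intended for I included in [0, \<infinity>), where both series have nonnegative terms, so that they
   converge in the extended reals; products there obey \<infinity> * 0 = 0. *)
definition hardy_bound ::
    "real set \<Rightarrow> (real list \<Rightarrow> real list \<Rightarrow> real) \<Rightarrow> (nat \<Rightarrow> real) \<Rightarrow> ereal \<Rightarrow> bool" where
  "hardy_bound I M l C \<longleftrightarrow>
    (\<forall>x. (\<forall>n. x n \<in> I) \<longrightarrow>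
       (\<Sum>n. ereal (l n * M (upto_term x n) (upto_term l n))) \<le> C * (\<Sum>n. ereal (l n * x n)))"

(* For inf I = 0 the infimum is attained: see hardy_bound_hardy_constant below. *)
definition hardy_constant ::
    "real set \<Rightarrow> (real list \<Rightarrow> real list \<Rightarrow> real) \<Rightarrow> (nat \<Rightarrow> real) \<Rightarrow> ereal" where
  "hardy_constant I M l = Inf {C. hardy_bound I M l C}"

(* If I is bounded, the mean in the definition of the constant is defined only for those y > 0
   for which all the y / (l_1 + ... + l_n) lie in I, and the supremum is over these y.
   For I = (0, \<infinity>) and I = [0, \<infinity>) this is every y > 0. *)
definition C_constant ::
    "real set \<Rightarrow> (real list \<Rightarrow> real list \<Rightarrow> real) \<Rightarrow> (nat \<Rightarrow> real) \<Rightarrow> ereal" where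
  "C_constant I M l =
    (SUP y\<in>{y. 0 < y \<and> (\<forall>n. y / psum l n \<in> I)}.
       liminf (\<lambda>n. ereal (psum l n / y * M (upto_term (\<lambda>k. y / psum l k) n) (upto_term l n))))"

lemma hardy_constant_le: "hardy_bound I M l C \<Longrightarrow> hardy_constant I M l \<le> C"
  unfolding hardy_constant_def by (rule Inf_lower) simp

lemma mean_between:
  assumes "weighted_mean I M" "x \<in> points I n" "w \<in> weights n"
  shows "Min (set x) \<le> M x w" "M x w \<le> Max (set x)"
  using assms unfolding weighted_mean_def by blast+

lemma mean_eq_0:
  assumes M: "weighted_mean I M" and I: "I \<subseteq> {0..}"
  shows "x \<in> points I n \<Longrightarrow> w \<in> weights n \<Longrightarrow> (\<And>i. i < n \<Longrightarrow> w ! i * x ! i = 0) \<Longrightarrow> M x w = 0"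
proof (induction n arbitrary: x w)
  case 0
  then show ?case by (auto simp: weights_def)
next
  case (Suc n)
  show ?case
  proof (cases "\<exists>j<Suc n. w ! j = 0")
    case True
    then obtain j where j: "j < Suc n" "w ! j = 0" by blast
    have len: "length x = Suc n" "length w = Suc n"
      using Suc.prems by (auto simp: points_def weights_def)
    have nth: "delete_nth j u ! i = u ! (if i < j then i else Suc i)"
      if "i < n" "length u = Suc n" for i and u :: "real list"
      using that j by (auto simp: delete_nth_def nth_append)
    have x': "delete_nth j x \<in> points I n"
      using Suc.prems(1) j len
      by (auto simp: points_def delete_nth_def dest!: in_set_takeD in_set_dropD)
    have "sum_list w = sum_list (take j w @ w ! j # drop (Suc j) w)"
      using id_take_nth_drop[of j w] j len by simp
    then have s: "sum_list (delete_nth j w) = sum_list w"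
      using j by (simp add: delete_nth_def)
    have w': "delete_nth j w \<in> weights n"
      using Suc.prems(2) j len s
      by (auto simp: weights_def delete_nth_def dest!: in_set_takeD in_set_dropD)
    have "M (delete_nth j x) (delete_nth j w) = 0"
      using Suc.IH[OF x' w'] Suc.prems(3) len nth by auto
    moreover have "M x w = M (delete_nth j x) (delete_nth j w)"
      using M Suc.prems(1,2) j unfolding weighted_mean_def by blast
    ultimately show ?thesis by simp
  next
    case False
    have "\<forall>i<Suc n. x ! i = 0" "length x = Suc n"
      using Suc.prems False by (auto simp: points_def)
    then have "set x = {0}" by (force simp: set_conv_nth)
    moreover note mean_between[OF M Suc.prems(1,2)]
    ultimately show ?thesis by simp
  qed
qed

lemma hardy_bound_hardy_constant:
  assumes I: "I \<noteq> {}" "bdd_below I" "Inf I = 0"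
    and M: "weighted_mean I M"
    and l: "0 < l 0" "\<And>n. 0 \<le> l n"
  shows "hardy_bound I M l (hardy_constant I M l)"
  unfolding hardy_bound_def
proof (intro allI impI)
  fix x :: "nat \<Rightarrow> real"
  assume x: "\<forall>n. x n \<in> I"
  define S where "S = (\<lambda>x. \<Sum>n. ereal (l n * x n))"
  define T where "T = (\<lambda>x. \<Sum>n. ereal (l n * M (upto_term x n) (upto_term l n)))"
  have Ipos: "I \<subseteq> {0..}" using I by (metis atLeast_iff cInf_lower subsetI)
  have pts: "upto_term x n \<in> points I (Suc n)" if "\<forall>n. x n \<in> I" for x n
    using that by (auto simp: upto_term_def points_def)
  have wts: "upto_term l n \<in> weights (Suc n)" for n
  proof -
    have "sum_list (upto_term l n) = psum l n"
      by (simp add: upto_term_def psum_def interv_sum_list_conv_sum_set_nat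
          atLeast0LessThan lessThan_Suc_atMost del: upt_Suc)
    moreover have "psum l n > 0"
      unfolding psum_def by (rule sum_pos2[of _ 0]) (use l in auto)
    ultimately show ?thesis using l by (auto simp: weights_def upto_term_def)
  qed
  have Mpos: "M (upto_term x n) (upto_term l n) \<ge> 0" if "\<forall>n. x n \<in> I" for x n
    using M pts[OF that, of n] wts[of n] Ipos unfolding weighted_mean_def by (meson atLeast_iff subsetD)
  have Tpos: "0 \<le> T x" if "\<forall>n. x n \<in> I" for x
    unfolding T_def using l Mpos[OF that] by (intro suminf_0_le) (auto simp: summable_ereal_pos)
  have Spos: "0 \<le> S x" if "\<forall>n. x n \<in> I" for x
    unfolding S_def using l that Ipos by (intro suminf_0_le) (auto simp: summable_ereal_pos subset_iff)
  have bnd: "T x \<le> C * S x" if "hardy_bound I M l C" "\<forall>n. x n \<in> I" for x C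
    using that unfolding hardy_bound_def S_def T_def by blast
  have "T x \<le> hardy_constant I M l * S x"
  proof (cases "S x = 0")
    case True
    have z: "l n * x n = 0" for n
    proof -
      have "ereal (l n * x n) \<le> S x"
        unfolding S_def using l x Ipos sums_ereal
        by (intro order_trans[OF _ suminf_upper[of _ "Suc n"]]) (auto simp: subset_iff sum_nonneg)
      then have "l n * x n \<le> 0" using True by simp
      moreover have "0 \<le> l n * x n" using l x Ipos by (auto simp: subset_iff intro!: mult_nonneg_nonneg)
      ultimately show ?thesis by simp
    qed
    have "M (upto_term x n) (upto_term l n) = 0" for n
      by (rule mean_eq_0[OF M Ipos pts[OF x] wts]) (auto simp: upto_term_def z simp del: upt_Suc)
    then show ?thesis by (simp add: T_def True flip: zero_ereal_def)
  next
    case False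
    then have S: "0 < S x" using Spos[OF x] by simp
    show ?thesis
    proof (cases "S x = \<infinity>")
      case True
      have "\<exists>a\<in>I. 0 < a"
      proof (rule ccontr)
        assume "\<not> ?thesis"
        then have "x n = 0" for n
          using x Ipos by (meson antisym atLeast_iff not_less subsetD)
        then show False using S by (simp add: S_def flip: zero_ereal_def)
      qed
      then obtain a where a: "a \<in> I" "0 < a" by blast
      have "\<exists>b\<in>I. l n * b \<le> (1/2)^n" for n
      proof -
        have "0 < (1/2)^n / (l n + 1)" using l(2)[of n] by simp
        then obtain b where b: "b \<in> I" "b < (1/2)^n / (l n + 1)"
          using I by (metis cInf_less_iff)
        have "l n * b \<le> (l n + 1) * b" using b Ipos by (auto simp: algebra_simps)
        also have "\<dots> \<le> (1/2)^n" using b l(2)[of n] by (simp add: pos_less_divide_eq mult.commute)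
        finally show ?thesis using b by blast
      qed
      then obtain b where b: "\<And>n. b n \<in> I" "\<And>n. l n * b n \<le> (1/2)^n" by metis
      define u where "u = b(0 := a)"
      have u: "\<forall>n. u n \<in> I" using a b by (simp add: u_def)
      have "summable (\<lambda>n. l n * u n)"
      proof (rule summable_comparison_test')
        show "summable (\<lambda>n. (1/2::real)^n)" by (simp add: summable_geometric)
        show "norm (l n * u n) \<le> (1/2)^n" if "n \<ge> 1" for n
          using that b[of n] l(2)[of n] Ipos by (auto simp: u_def subset_iff abs_mult)
      qed
      then obtain s where s: "S u = ereal s" unfolding S_def using suminf_ereal' by blast
      have Tu: "ereal (l 0 * a) \<le> T u"
      proof -
        have "M [a] [l 0] = a"
          using mean_between[OF M pts[OF u, of 0] wts[of 0]] by (simp add: upto_term_def u_def)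
        then have "ereal (l 0 * a) = (\<Sum>n<Suc 0. ereal (l n * M (upto_term u n) (upto_term l n)))"
          by (simp add: upto_term_def u_def)
        also have "\<dots> \<le> T u"
          unfolding T_def using l Mpos[OF u] by (intro suminf_upper) auto
        finally show ?thesis .
      qed
      have la: "0 < l 0 * a" using l a by simp
      have s0: "0 \<le> s" using Spos[OF u] s by simp
      have low: "ereal (l 0 * a / (s + 1)) \<le> C" if "hardy_bound I M l C" for C
      proof -
        have C: "ereal (l 0 * a) \<le> C * ereal s" using Tu bnd[OF that u] s by (metis order_trans)
        show ?thesis
        proof (cases C)
          case (real c)
          then have "l 0 * a \<le> c * s" using C by simp
          moreover from this have "0 < c" using la s0 by (smt (verit) mult_nonneg_nonneg mult_nonpos_nonneg)
          ultimately show ?thesis using real s0 by (simp add: field_simps)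
        next
          case MInf
          then show ?thesis using C la s0 by (cases "s = 0") simp_all
        qed auto
      qed
      have "ereal (l 0 * a / (s + 1)) \<le> hardy_constant I M l"
        unfolding hardy_constant_def by (rule Inf_greatest) (use low in auto)
      moreover have "0 < ereal (l 0 * a / (s + 1))" using la s0 by simp
      ultimately have "0 < hardy_constant I M l" by (rule less_le_trans[rotated])
      then show ?thesis using True by (simp add: less_imp_neq[THEN not_sym])
    next
      case False
      with S obtain s where s: "S x = ereal s" "0 < s" by (cases "S x") auto
      have "T x / S x \<le> hardy_constant I M l"
        unfolding hardy_constant_def
      proof (rule Inf_greatest)
        fix C assume "C \<in> {C. hardy_bound I M l C}"
        then have "T x \<le> C * S x" using bnd x by simp
        then show "T x / S x \<le> C" using s by (simp add: ereal_divide_le_pos mult.commute)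
      qed
      then show ?thesis using s by (simp add: ereal_divide_le_pos mult.commute)
    qed
  qed
  then show "(\<Sum>n. ereal (l n * M (upto_term x n) (upto_term l n)))
      \<le> hardy_constant I M l * (\<Sum>n. ereal (l n * x n))"
    by (simp add: S_def T_def)
qed

end

(* Through the reduction and elimination principles and symmetry, the mean depends only on the
   distribution of the weight over the values.  Jensen concavity then says that replacing parts of
   this distribution by their barycentres does not decrease the mean; for two points with a dyadic
   ratio this is repeated halving, and the general ratio follows by monotonicity in the values and
   continuity in the weights.

   This yields the weighted Kedlaya inequality: with A_n the weighted average of x_1, ..., x_n and
   L_n = l_1 + ... + l_n, the sum of l_n M(x_1, ..., x_n) over n <= N is at most
   L_N M(A_1, ..., A_N).  The induction on N rests on the identity
     L_(N+1) A_i = l_(N+1) x_i + L_N ((1 - t_i) A_i + t_i A_(i-1)),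
   where t_i = (l_(N+1) / L_N) (L_(i-1) / l_i).  The condition on l is exactly t_i <= 1, and the
   weight that the pairs (1 - t_i) A_i, t_i A_(i-1) carry on A_1, ..., A_N is proportional to
   l_1, ..., l_N.  As A_n <= (sum of l_k x_k) / L_n, the upper bound follows by monotonicity; for
   bounded I the points are first shrunk by a factor t, since M(t x) >= t M(x) by concavity.

   For the lower bound, take x_n = y / L_n up to N and continue with a tail of bounded total
   weight; the sum of l_n / L_n diverges when the sum of l_n does. *)
theory Submission
  imports Defs
begin

section \<open>Finite weighted distributions\<close>

text \<open>A pair is (value, weight), so such a list codes a finite measure on I of positive total
  mass. Repeated values and zero weights are allowed.\<close>

definition admissible :: "real set \<Rightarrow> (real \<times> real) list \<Rightarrow> bool" where
  "admissible I ps \<longleftrightarrow> fst ` set ps \<subseteq> I \<and> (\<forall>p\<in>set ps. 0 \<le> snd p) \<and> 0 < (\<Sum>p\<leftarrow>ps. snd p)"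

text \<open>The integral of f against the measure coded by \<open>ps\<close>. Two lists code the
  same measure when all these integrals agree, which can be checked by plain algebra, without
  collecting equal values.\<close>

definition weighted_sum :: "(real \<times> real) list \<Rightarrow> (real \<Rightarrow> real) \<Rightarrow> real" where
  "weighted_sum ps f = (\<Sum>p\<leftarrow>ps. snd p * f (fst p))"

lemma weighted_sum_simps [simp]:
  "weighted_sum [] f = 0"
  "weighted_sum (p # ps) f = snd p * f (fst p) + weighted_sum ps f"
  "weighted_sum (ps @ qs) f = weighted_sum ps f + weighted_sum qs f"
  by (simp_all add: weighted_sum_def)

lemma admissible_Cons:
  "admissible I (p # ps) \<longleftrightarrow> fst p \<in> I \<and> 0 \<le> snd p \<and> fst ` set ps \<subseteq> I \<and>
    (\<forall>p\<in>set ps. 0 \<le> snd p) \<and> 0 < snd p + (\<Sum>p\<leftarrow>ps. snd p)"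
  by (auto simp: admissible_def)

lemma admissible_mset: "mset ps = mset qs \<Longrightarrow> admissible I ps \<longleftrightarrow> admissible I qs"
  unfolding admissible_def by (metis mset_eq_setD mset_map sum_mset_sum_list)

lemma sum_list_filter_nonzero: "(\<Sum>p\<leftarrow>filter (\<lambda>p. snd p \<noteq> 0) ps. snd p) = (\<Sum>p\<leftarrow>ps. snd p :: real)"
  by (induction ps) auto

lemma weighted_sum_filter: "weighted_sum (filter (\<lambda>p. snd p \<noteq> 0) ps) f = weighted_sum ps f"
  by (induction ps) auto

lemma mset_zip_splice:
  "length xs = length us \<Longrightarrow> length ys = length vs \<Longrightarrow> length xs = length ys \<Longrightarrow>
    mset (zip (splice xs ys) (splice us vs)) = mset (zip xs us) + mset (zip ys vs)"
proof (induction xs arbitrary: us ys vs)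
  case (Cons x xs)
  then show ?case by (cases us; cases ys; cases vs) auto
qed auto

lemma weighted_sum_indicator_zero:
  "a \<notin> fst ` set ps \<Longrightarrow> weighted_sum ps (\<lambda>b. of_bool (b = a)) = 0"
  by (induction ps) auto

lemma weighted_sum_eq_distinct:
  assumes "distinct (map fst ps)" "a \<in> fst ` set ps"
  shows "(a, weighted_sum ps (\<lambda>b. of_bool (b = a))) \<in> set ps"
  using assms
proof (induction ps)
  case (Cons p ps)
  show ?case using Cons weighted_sum_indicator_zero[of a] by (cases p; cases "fst p = a") auto
qed auto

text \<open>For distinct values, integrating the indicator of a point returns its weight. A point of
  one list has nonzero weight there, hence also in the other list, with the same weight.\<close>

lemma set_eq_of_weighted_sum_eq:
  assumes "distinct (map fst ps)" "distinct (map fst qs)"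
    and "\<forall>p\<in>set ps. snd p \<noteq> 0" "\<forall>p\<in>set qs. snd p \<noteq> 0"
    and "\<And>f. weighted_sum ps f = weighted_sum qs f"
  shows "set ps = set qs"
proof -
  have sub: "set ps \<subseteq> set qs"
    if "distinct (map fst ps)" "distinct (map fst qs)" "\<forall>p\<in>set ps. snd p \<noteq> 0"
      "\<And>f. weighted_sum ps f = weighted_sum qs f" for ps qs
  proof
    fix p assume p: "p \<in> set ps"
    obtain a w where aw: "p = (a, w)" by force
    define f where "f = (\<lambda>b::real. of_bool (b = a) :: real)"
    have "(a, weighted_sum ps f) \<in> set ps"
      unfolding f_def by (rule weighted_sum_eq_distinct) (use that p aw in force)+
    then have w: "w = weighted_sum ps f"
      using that(1) p aw by (metis eq_key_imp_eq_value)
    then have "weighted_sum qs f \<noteq> 0" using that p aw by force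
    then have "a \<in> fst ` set qs" using weighted_sum_indicator_zero f_def by blast
    then have "(a, weighted_sum qs f) \<in> set qs"
      unfolding f_def using that(2) by (intro weighted_sum_eq_distinct)
    then show "p \<in> set qs" using w aw that(4) by simp
  qed
  show ?thesis using sub[of ps qs] sub[of qs ps] assms by auto
qed

lemma weighted_sum_upt:
  "weighted_sum (map (\<lambda>i. (a i, w i)) [0..<n]) f = (\<Sum>i<n. w i * f (a i))"
  by (induction n) auto

text \<open>The list has the shape of the split list in \<open>m_split_all\<close>.\<close>

lemma weighted_sum_split_upt:
  "weighted_sum (concat (map (\<lambda>i. [(a i, (1 - t i) * w i), (b i, t i * w i)]) [0..<n])) f
    = (\<Sum>i<n. (1 - t i) * w i * f (a i) + t i * w i * f (b i))"
  by (induction n) auto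

lemma admissible_upt:
  assumes "\<And>i. i < n \<Longrightarrow> x i \<in> I" "\<And>i. i < n \<Longrightarrow> 0 \<le> w i" "0 < (\<Sum>i<n. w i)"
  shows "admissible I (map (\<lambda>i. (x i, w i)) [0..<n])"
  using assms weighted_sum_upt[of x w n "\<lambda>_. 1"] by (auto simp: admissible_def weighted_sum_def)

section \<open>Means as functions of distributions\<close>

text \<open>Each halving step halves the lower bound for the difference between the function and its
  chord, so the boundedness below already gives the inequality up to the end points.\<close>

lemma midpoint_concave_chord:
  fixes \<phi> :: "real \<Rightarrow> real"
  assumes mid: "\<And>u v. u \<in> {0..1} \<Longrightarrow> v \<in> {0..1} \<Longrightarrow> (\<phi> u + \<phi> v) / 2 \<le> \<phi> ((u + v) / 2)"
    and bound: "\<And>u. u \<in> {0..1} \<Longrightarrow> K \<le> \<phi> u"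
    and s: "s \<in> {0..1}"
  shows "(1 - s) * \<phi> 0 + s * \<phi> 1 \<le> \<phi> s"
proof -
  define g where "g = (\<lambda>u. \<phi> u - ((1 - u) * \<phi> 0 + u * \<phi> 1))"
  define B where "B = \<bar>K\<bar> + \<bar>\<phi> 0\<bar> + \<bar>\<phi> 1\<bar>"
  have g: "- B / 2 ^ k \<le> g u" if "u \<in> {0..1}" for k u
    using that
  proof (induction k arbitrary: u)
    case 0
    have le: "c * r \<le> \<bar>r\<bar>" if "0 \<le> c" "c \<le> 1" for c r :: real
      using that mult_left_mono[OF abs_ge_self that(1), of r] mult_left_le_one_le[of "\<bar>r\<bar>" c] by simp
    have "(1 - u) * \<phi> 0 \<le> \<bar>\<phi> 0\<bar>" "u * \<phi> 1 \<le> \<bar>\<phi> 1\<bar>"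
      using 0 by (auto intro!: le)
    then show ?case using bound[OF 0] by (simp add: g_def B_def)
  next
    case (Suc k)
    have mid_g: "(g u + g v) / 2 \<le> g ((u + v) / 2)" if "u \<in> {0..1}" "v \<in> {0..1}" for u v
      using mid[OF that] by (simp add: g_def field_simps)
    show ?case
    \<comment> \<open>u is the midpoint of an end point, where g vanishes, and of 2 u or 2 u -
      1.\<close>
    proof (cases "u \<le> 1/2")
      case True
      then have "(g 0 + g (2 * u)) / 2 \<le> g u" using mid_g[of 0 "2 * u"] Suc.prems by simp
      moreover have "g 0 = 0" by (simp add: g_def)
      moreover have "- B / 2 ^ k \<le> g (2 * u)" using Suc True by simp
      ultimately show ?thesis by simp
    next
      case False
      then have "(g 1 + g (2 * u - 1)) / 2 \<le> g u" using mid_g[of 1 "2 * u - 1"] Suc.prems by simp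
      moreover have "g 1 = 0" by (simp add: g_def)
      moreover have "- B / 2 ^ k \<le> g (2 * u - 1)" using Suc False by simp
      ultimately show ?thesis by simp
    qed
  qed
  have "(\<lambda>k. - B * (1/2) ^ k) \<longlonglongrightarrow> - B * 0" by (intro tendsto_intros) auto
  moreover have "- B * (1/2) ^ k \<le> g s" for k using g[OF s, of k] by (simp add: power_divide)
  ultimately have "0 \<le> g s" using LIMSEQ_le_const2[of "\<lambda>k. - B * (1/2) ^ k" "- B * 0" "g s"] by auto
  then show ?thesis by (simp add: g_def)
qed

text \<open>\<open>nonneg\<close> and \<open>small\<close> together say that I is nonempty with
  infimum 0, whether or not 0 belongs to I.\<close>

locale hardy_mean =
  fixes I :: "real set" and M :: "real list \<Rightarrow> real list \<Rightarrow> real"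
  assumes interval: "is_interval I"
    and nonneg: "I \<subseteq> {0..}"
    and small: "0 < e \<Longrightarrow> \<exists>b\<in>I. b < e"
    and mean: "weighted_mean I M"
    and symmetric: "symmetric_mean I M"
    and monotone: "monotone_mean I M"
    and jensen: "jensen_concave_mean I M"
    and cont: "continuous_in_weights I M"
begin

section \<open>The mean depends only on the distribution\<close>

definition m :: "(real \<times> real) list \<Rightarrow> real" where
  "m ps = M (map fst ps) (map snd ps)"

lemma admissible_points: "admissible I ps \<Longrightarrow> map fst ps \<in> points I (length ps)"
  and admissible_weights: "admissible I ps \<Longrightarrow> map snd ps \<in> weights (length ps)"
  by (auto simp: admissible_def points_def weights_def)

lemma m_mset:
  assumes "admissible I ps" "mset ps = mset qs"
  shows "m ps = m qs"
proof -
  obtain \<sigma> where \<sigma>: "\<sigma> permutes {..<length ps}" "permute_list \<sigma> ps = qs"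
    using mset_eq_permutation[OF assms(2)[symmetric]] by blast
  have "m ps = M (permute_list \<sigma> (map fst ps)) (permute_list \<sigma> (map snd ps))"
    using symmetric admissible_points[OF assms(1)] admissible_weights[OF assms(1)] \<sigma>(1)
    unfolding symmetric_mean_def m_def by blast
  then show ?thesis using \<sigma> by (simp add: permute_list_map m_def)
qed

lemma m_filter:
  assumes "admissible I ps"
  shows "m (filter (\<lambda>p. snd p \<noteq> 0) ps) = m ps"
  using assms
proof (induction "length ps" arbitrary: ps)
  case (Suc n)
  show ?case
  proof (cases "\<forall>p\<in>set ps. snd p \<noteq> 0")
    case True
    then show ?thesis by simp
  next
    case False
    then obtain j where j: "j < length ps" "snd (ps ! j) = 0" by (metis in_set_conv_nth)
    define qs where "qs = delete_nth j ps"
    have ps: "ps = take j ps @ ps ! j # drop (Suc j) ps" using j by (simp add: id_take_nth_drop)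
    have f: "filter (\<lambda>p. snd p \<noteq> 0) ps = filter (\<lambda>p. snd p \<noteq> 0) qs"
      by (subst ps) (use j in \<open>simp add: qs_def delete_nth_def\<close>)
    have "(\<Sum>p\<leftarrow>ps. snd p) = (\<Sum>p\<leftarrow>qs. snd p)"
      by (metis f sum_list_filter_nonzero)
    moreover have "set qs \<subseteq> set ps"
      unfolding qs_def delete_nth_def by (auto dest: in_set_takeD in_set_dropD)
    ultimately have adm: "admissible I qs"
      using Suc.prems unfolding admissible_def by auto
    have "length qs = n" using j Suc.hyps(2) by (simp add: qs_def delete_nth_def)
    then have "m (filter (\<lambda>p. snd p \<noteq> 0) qs) = m qs" using Suc.hyps(1) adm by simp
    also have "\<dots> = M (delete_nth j (map fst ps)) (delete_nth j (map snd ps))"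
      by (simp add: m_def qs_def delete_nth_def take_map drop_map)
    also have "\<dots> = m ps"
      using mean admissible_points[OF Suc.prems] admissible_weights[OF Suc.prems] j
      unfolding weighted_mean_def m_def by (metis (no_types, lifting) nth_map)
    finally show ?thesis using f by simp
  qed
qed auto

text \<open>The reduction principle is applied to the values of the merged list, with a second
  weight vector concentrated on the first entry. Splicing then gives (a, u), (a, v),
  \<open>ps\<close> and copies of \<open>ps\<close> of weight zero, which symmetry and elimination
  remove. Both weight vectors must have positive total, so a vanishing u or v is left to
  elimination.\<close>

lemma m_merge:
  assumes adm: "admissible I ((a, u) # (a, v) # ps)"
  shows "m ((a, u) # (a, v) # ps) = m ((a, u + v) # ps)"
proof -
  have adm': "admissible I ((a, u + v) # ps)" using adm by (auto simp: admissible_Cons)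
  show ?thesis
  proof (cases "u = 0 \<or> v = 0")
    case True
    then have "filter (\<lambda>p. snd p \<noteq> 0) ((a, u) # (a, v) # ps) = filter (\<lambda>p. snd p \<noteq> 0) ((a, u + v) # ps)"
      by auto
    then show ?thesis by (metis adm adm' m_filter)
  next
    case False
    then have uv: "0 < u" "0 < v" using adm by (auto simp: admissible_Cons)
    let ?x = "a # map fst ps" and ?v = "u # map snd ps" and ?w = "v # map (\<lambda>_. 0) ps"
    let ?zs = "zip (splice ?x ?x) (splice ?v ?w)"
    have x: "?x \<in> points I (Suc (length ps))"
      using adm by (auto simp: admissible_Cons points_def)
    have nn: "0 \<le> sum_list (map snd ps)" using adm by (intro sum_list_nonneg) (auto simp: admissible_Cons)
    have v: "?v \<in> weights (Suc (length ps))"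
      using adm uv nn by (auto simp: admissible_Cons weights_def)
    have w: "?w \<in> weights (Suc (length ps))"
      using uv by (auto simp: weights_def sum_list_triv)
    have pw: "map2 (+) ?v ?w = map snd ((a, u + v) # ps)"
      by (auto simp: map_eq_conv zip_map1 zip_map2 zip_same_conv_map o_def intro!: nth_equalityI)
    have "m ((a, u + v) # ps) = M ?x (map2 (+) ?v ?w)" by (simp only: pw m_def) simp
    also have "\<dots> = M (splice ?x ?x) (splice ?v ?w)"
      using mean x v w unfolding weighted_mean_def by blast
    also have "\<dots> = m ?zs" by (simp add: m_def)
    finally have eq: "m ((a, u + v) # ps) = m ?zs" .
    have z: "mset ?zs = mset ((a, u) # ps) + mset ((a, v) # map (\<lambda>p. (fst p, 0)) ps)"
      by (subst mset_zip_splice) (simp_all add: zip_map_fst_snd zip_map1 zip_map2 zip_same_conv_map o_def)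
    have fz: "mset (filter (\<lambda>p. snd p \<noteq> 0) ?zs) = mset (filter (\<lambda>p. snd p \<noteq> 0) ((a, u) # (a, v) # ps))"
      unfolding mset_filter z by (simp add: filter_mset_eq_conv)
    have "admissible I ((a, u) # ps @ (a, v) # map (\<lambda>p. (fst p, 0)) ps)"
      using adm by (auto simp: admissible_Cons o_def)
    then have admz: "admissible I ?zs"
      using admissible_mset[of ?zs "(a, u) # ps @ (a, v) # map (\<lambda>p. (fst p, 0)) ps"] z by simp
    have "admissible I (filter (\<lambda>p. snd p \<noteq> 0) ?zs)"
      using admz sum_list_filter_nonzero[of ?zs] unfolding admissible_def by auto
    then have "m (filter (\<lambda>p. snd p \<noteq> 0) ?zs) = m (filter (\<lambda>p. snd p \<noteq> 0) ((a, u) # (a, v) # ps))"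
      using m_mset fz by blast
    then show ?thesis using m_filter[OF admz] m_filter[OF adm] eq by simp
  qed
qed

text \<open>Each repeated value is brought to the front and merged, which shortens the list; once
  the values are distinct, the zero weights are dropped.\<close>

lemma m_normal_form:
  assumes "admissible I ps"
  shows "\<exists>qs. distinct (map fst qs) \<and> (\<forall>p\<in>set qs. snd p \<noteq> 0) \<and> admissible I qs \<and> m qs = m ps \<and>
    (\<forall>f. weighted_sum qs f = weighted_sum ps f)"
  using assms
proof (induction "length ps" arbitrary: ps rule: less_induct)
  case less
  show ?case
  proof (cases "distinct (map fst ps)")
    case True
    then show ?thesis
      using less.prems m_filter[OF less.prems] weighted_sum_filter[of ps] sum_list_filter_nonzero[of ps]
      by (intro exI[of _ "filter (\<lambda>p. snd p \<noteq> 0) ps"]) (auto simp: admissible_def distinct_map_filter)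
  next
    case False
    then obtain as bs cs a where "map fst ps = as @ [a] @ bs @ [a] @ cs"
      using not_distinct_decomp by blast
    then obtain p1 u p2 v p3 where ps: "ps = p1 @ (a, u) # p2 @ (a, v) # p3"
      by (auto simp: map_eq_append_conv append_eq_map_conv Cons_eq_map_conv)
    define qs where "qs = (a, u) # (a, v) # p1 @ p2 @ p3"
    define rs where "rs = (a, u + v) # p1 @ p2 @ p3"
    have ms: "mset ps = mset qs" by (simp add: ps qs_def)
    then have adm: "admissible I qs" using less.prems admissible_mset by blast
    have mm: "m rs = m ps" using m_merge adm m_mset[OF less.prems ms] by (simp add: qs_def rs_def)
    have "admissible I rs" using adm unfolding qs_def rs_def by (auto simp: admissible_Cons)
    moreover have "length rs < length ps" by (simp add: rs_def ps)
    moreover have "weighted_sum rs f = weighted_sum ps f" for f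
      by (simp add: rs_def ps algebra_simps)
    ultimately show ?thesis using less.hyps[of rs] mm by auto
  qed
qed

text \<open>Two normal forms of the same measure have the same set of pairs, so they are
  permutations of each other and symmetry applies. Every later rearrangement of weights that is more
  than a permutation goes through this lemma.\<close>

lemma m_cong_law:
  assumes "admissible I ps" "admissible I qs" "\<And>f. weighted_sum ps f = weighted_sum qs f"
  shows "m ps = m qs"
proof -
  obtain ps' where p: "distinct (map fst ps')" "\<forall>p\<in>set ps'. snd p \<noteq> 0" "admissible I ps'"
    "m ps' = m ps" "\<And>f. weighted_sum ps' f = weighted_sum ps f"
    using m_normal_form[OF assms(1)] by blast
  obtain qs' where q: "distinct (map fst qs')" "\<forall>p\<in>set qs'. snd p \<noteq> 0" "admissible I qs'"
    "m qs' = m qs" "\<And>f. weighted_sum qs' f = weighted_sum qs f"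
    using m_normal_form[OF assms(2)] by blast
  have "set ps' = set qs'"
    using p q assms(3) by (intro set_eq_of_weighted_sum_eq) auto
  then have "mset ps' = mset qs'"
    using p(1) q(1) by (metis distinct_map set_eq_iff_mset_eq_distinct)
  then show ?thesis using m_mset p q by metis
qed

section \<open>Monotonicity and replacement by barycentres\<close>

lemma convex_combination_mem:
  assumes "a \<in> I" "b \<in> I" "0 \<le> t" "t \<le> 1"
  shows "(1 - t) * a + t * b \<in> I"
proof -
  have "convex I" using interval is_interval_convex by blast
  then show ?thesis using assms convexD_alt[of I a b t] by simp
qed

lemma M_mono:
  assumes x: "x \<in> points I n" and y: "y \<in> points I n" and w: "w \<in> weights n"
    and le: "\<And>i. i < n \<Longrightarrow> x ! i \<le> y ! i"
  shows "M x w \<le> M y w"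
proof -
  have len: "length x = n" "length y = n" using x y by (auto simp: points_def)
  \<comment> \<open>\<open>monotone_mean\<close> changes one coordinate at a time, so the first k
    coordinates are replaced successively.\<close>
  have "M x w \<le> M (take k y @ drop k x) w" if "k \<le> n" for k
    using that
  proof (induction k)
    case (Suc k)
    let ?z = "take k y @ drop k x"
    have z: "?z \<in> points I n"
      using x y Suc.prems by (auto simp: points_def dest: in_set_takeD in_set_dropD)
    have "y ! k \<in> I" using y Suc.prems by (auto simp: points_def)
    moreover have "?z ! k \<le> y ! k" using le Suc.prems len by (simp add: nth_append)
    ultimately have "M ?z w \<le> M (?z[k := y ! k]) w"
      using monotone z w Suc.prems unfolding monotone_mean_def by (metis Suc_le_eq)
    also have "?z[k := y ! k] = take (Suc k) y @ drop (Suc k) x"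
      using len Suc.prems by (intro nth_equalityI) (auto simp: nth_list_update nth_append less_Suc_eq)
    finally show ?case using Suc by simp
  qed simp
  from this[of n] show ?thesis using len by simp
qed

lemma m_mono_head:
  assumes "admissible I ((a, w) # ps)" "b \<in> I" "a \<le> b"
  shows "m ((a, w) # ps) \<le> m ((b, w) # ps)"
proof -
  let ?n = "Suc (length ps)"
  have "a # map fst ps \<in> points I ?n" "b # map fst ps \<in> points I ?n" "w # map snd ps \<in> weights ?n"
    using assms by (auto simp: admissible_Cons points_def weights_def)
  then show ?thesis using assms(3) M_mono[of "a # map fst ps" ?n "b # map fst ps" "w # map snd ps"]
    by (auto simp: m_def nth_Cons split: nat.splits)
qed

text \<open>Jensen concavity is applied to the values a, b and their swap b, a. As a and b carry
  equal weights, both have the same mean, so the average on the lower side is that mean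
  itself.\<close>

lemma m_midpoint:
  assumes adm: "admissible I ((a, w) # ps)" and b: "b \<in> I"
  shows "m ((a, w / 2) # (b, w / 2) # ps) \<le> m (((a + b) / 2, w) # ps)"
proof -
  define c where "c = (a + b) / 2"
  have ab: "a \<in> I" "0 \<le> w" using adm by (auto simp: admissible_Cons)
  then have c: "c \<in> I" using convex_combination_mem[of a b "1/2"] b by (simp add: c_def field_simps)
  let ?n = "Suc (Suc (length ps))"
  let ?x = "a # b # map fst ps" and ?y = "b # a # map fst ps" and ?w = "w / 2 # w / 2 # map snd ps"
  have mem: "?x \<in> points I ?n" "?y \<in> points I ?n" "?w \<in> weights ?n"
    using adm b by (auto simp: admissible_Cons points_def weights_def)
  have z: "map2 (\<lambda>a b. (a + b) / 2) ?x ?y = c # c # map fst ps"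
    by (auto simp: c_def zip_same_conv_map o_def)
  have "(M ?x ?w + M ?y ?w) / 2 \<le> M (c # c # map fst ps) ?w"
    using jensen mem z unfolding jensen_concave_mean_def by metis
  moreover have "M ?y ?w = M ?x ?w"
    using m_cong_law[of "(b, w / 2) # (a, w / 2) # ps" "(a, w / 2) # (b, w / 2) # ps"] adm b
    by (auto simp: m_def admissible_Cons)
  moreover have "M (c # c # map fst ps) ?w = m ((c, w) # ps)"
    using m_cong_law[of "(c, w / 2) # (c, w / 2) # ps" "(c, w) # ps"] adm c
    by (auto simp: m_def admissible_Cons algebra_simps)
  ultimately show ?thesis by (simp add: m_def c_def)
qed

text \<open>Let t = s / 2 with s of level k. Half of the weight stays at a; the other half, split
  with ratio s, gathers at d = (1 - s) a + s b by induction. Then \<open>m_midpoint\<close> joins a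
  and d at (a + d) / 2 = (1 - t) a + t b. Ratios above 1/2 are reached by exchanging a and
  b.\<close>

lemma m_split_dyadic:
  fixes p k :: nat
  assumes "p \<le> 2 ^ k" "admissible I ((a, w) # ps)" "b \<in> I"
  defines "t \<equiv> real p / 2 ^ k"
  shows "m ((a, (1 - t) * w) # (b, t * w) # ps) \<le> m (((1 - t) * a + t * b, w) # ps)"
  using assms(1-3) unfolding t_def
proof (induction k arbitrary: p a b w ps)
  case 0
  then consider "p = 0" | "p = 1" by force
  then show ?case
  proof cases
    case 1
    then show ?thesis using 0 m_cong_law[of "(a, w) # (b, 0) # ps" "(a, w) # ps"]
      by (auto simp: admissible_Cons)
  next
    case 2
    then show ?thesis using 0 m_cong_law[of "(a, 0) # (b, w) # ps" "(b, w) # ps"]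
      by (auto simp: admissible_Cons)
  qed
next
  case (Suc k)
  have step: "m ((a, (1 - t) * w) # (b, t * w) # ps) \<le> m (((1 - t) * a + t * b, w) # ps)"
    if t: "t = real q / 2 ^ k / 2" and q: "q \<le> 2 ^ k" and adm: "admissible I ((a, w) # ps)"
      and b: "b \<in> I" for q t a b ps
  proof -
    define s where "s = real q / 2 ^ k"
    have "real q \<le> 2 ^ k" using q by (metis of_nat_le_iff of_nat_numeral of_nat_power)
    then have s: "0 \<le> s" "s \<le> 1" "t = s / 2" using t by (auto simp: s_def)
    have a: "a \<in> I" "0 \<le> w" using adm by (auto simp: admissible_Cons)
    define d where "d = (1 - s) * a + s * b"
    have d: "d \<in> I" using convex_combination_mem a b s d_def by auto
    have adm1: "admissible I ((a, w / 2) # (a, w / 2) # ps)"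
      and adm2: "admissible I ((d, w / 2) # (a, w / 2) # ps)"
      and adm3: "admissible I ((a, w / 2) # (d, w / 2) # ps)"
      using adm d by (auto simp: admissible_Cons)
    have sw: "0 \<le> (1 - s) * w" "0 \<le> s * w" using s a by simp_all
    have s2: "(1 - s) * w + s * w = w" by (simp add: algebra_simps)
    \<comment> \<open>The induction hypothesis is used with weight w / 2; the resting half (a, w /
      2) is moved into the remaining list.\<close>
    have "m ((a, (1 - s) * (w / 2)) # (b, s * (w / 2)) # (a, w / 2) # ps) \<le> m ((d, w / 2) # (a, w / 2) # ps)"
      using Suc.IH[OF q adm1 b] by (simp add: s_def d_def)
    moreover have "m ((d, w / 2) # (a, w / 2) # ps) = m ((a, w / 2) # (d, w / 2) # ps)"
      using adm2 adm3 by (intro m_mset) auto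
    moreover have "m ((a, w / 2) # (d, w / 2) # ps) \<le> m (((a + d) / 2, w) # ps)"
      using m_midpoint[OF adm d] .
    moreover have "(a + d) / 2 = (1 - t) * a + t * b" by (simp add: d_def s field_simps)
    moreover have "m ((a, (1 - s) * (w / 2)) # (b, s * (w / 2)) # (a, w / 2) # ps)
        = m ((a, (1 - t) * w) # (b, t * w) # ps)"
      using adm b a sw s2 s by (intro m_cong_law) (auto simp: admissible_Cons field_simps)
    ultimately show ?thesis by simp
  qed
  have a: "a \<in> I" "0 \<le> w" using Suc.prems by (auto simp: admissible_Cons)
  show ?case
  proof (cases "p \<le> 2 ^ k")
    case True
    then show ?thesis using step[of "real p / 2 ^ Suc k" p a ps b] Suc.prems by simp
  next
    case False
    define t where "t = real p / 2 ^ Suc k"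
    define q where "q = 2 ^ Suc k - p"
    have q: "q \<le> 2 ^ k" using False by (simp add: q_def)
    have "real q = 2 ^ Suc k - real p" using Suc.prems(1) by (simp add: q_def of_nat_diff)
    then have tq: "1 - t = real q / 2 ^ k / 2" by (simp add: t_def field_simps)
    have t01: "0 \<le> t" "t \<le> 1"
      using Suc.prems(1) unfolding t_def by (auto simp: of_nat_le_iff[symmetric, where 'a = real] simp del: of_nat_le_iff)
    have "admissible I ((b, w) # ps)" using Suc.prems by (auto simp: admissible_Cons)
    then have "m ((b, t * w) # (a, (1 - t) * w) # ps) \<le> m ((t * b + (1 - t) * a, w) # ps)"
      using step[OF tq q _ a(1), of b ps] by simp
    moreover have "m ((b, t * w) # (a, (1 - t) * w) # ps) = m ((a, (1 - t) * w) # (b, t * w) # ps)"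
      using Suc.prems a t01 mult_left_le_one_le[of w t] by (intro m_mset) (auto simp: admissible_Cons algebra_simps)
    ultimately show ?thesis by (simp add: t_def add.commute)
  qed
qed

lemma continuous_on_weights:
  assumes x: "x \<in> points I n" and w: "\<And>t. t \<in> T \<Longrightarrow> w t \<in> weights n"
    and c: "\<And>i. i < n \<Longrightarrow> continuous_on T (\<lambda>t::real. w t ! i)"
  shows "continuous_on T (\<lambda>t. M x (w t))"
proof -
  \<comment> \<open>Padding with zeros makes the weight list a point of
    \<open>Euclidean_space n\<close>, where continuity in the weights is stated.\<close>
  define g where "g = (\<lambda>t i. if i < n then w t ! i else 0)"
  have g: "map (g t) [0..<n] = w t" if "t \<in> T" for t
    using w[OF that] by (auto simp: g_def weights_def intro!: nth_equalityI)
  have "continuous_map (top_of_set T) (powertop_real UNIV) g"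
    using c by (auto simp: continuous_map_componentwise_UNIV g_def)
  then have "continuous_map (top_of_set T) (subtopology (Euclidean_space n) {v. map v [0..<n] \<in> weights n}) g"
    unfolding Euclidean_space_def
    by (intro continuous_map_into_subtopology) (auto simp: g_def[THEN fun_cong, THEN fun_cong] g w)
  then have "continuous_map (top_of_set T) euclideanreal ((\<lambda>v. M x (map v [0..<n])) \<circ> g)"
    using cont x unfolding continuous_in_weights_def by (metis continuous_map_compose)
  then show ?thesis by (simp add: o_def g cong: continuous_on_cong)
qed

text \<open>For a <= b, dyadic ratios s k tend to t from below. On the left, continuity in the
  weights gives the limit; on the right, the barycentre for s k lies below the one for t, so
  monotonicity suffices. The case a > b follows by exchanging the points and replacing t by 1 -
  t.\<close>

lemma m_split:
  assumes adm: "admissible I ((a, w) # ps)" and b: "b \<in> I" and t: "0 \<le> t" "t \<le> 1"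
  shows "m ((a, (1 - t) * w) # (b, t * w) # ps) \<le> m (((1 - t) * a + t * b, w) # ps)"
proof -
  have *: "m ((a, (1 - t) * w) # (b, t * w) # ps) \<le> m (((1 - t) * a + t * b, w) # ps)"
    if adm: "admissible I ((a, w) # ps)" and b: "b \<in> I" and t: "0 \<le> t" "t \<le> 1" and ab: "a \<le> b" for a b t
  proof -
    have a: "a \<in> I" "0 \<le> w" using adm by (auto simp: admissible_Cons)
    define h where "h = (\<lambda>t. m ((a, (1 - t) * w) # (b, t * w) # ps))"
    have "continuous_on {0..1} (\<lambda>t. M (a # b # map fst ps) ((1 - t) * w # t * w # map snd ps))"
    proof (rule continuous_on_weights)
      show "a # b # map fst ps \<in> points I (Suc (Suc (length ps)))"
        using adm b by (auto simp: admissible_Cons points_def)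
      show "(1 - t) * w # t * w # map snd ps \<in> weights (Suc (Suc (length ps)))" if "t \<in> {0..1}" for t
        using adm a that mult_left_le_one_le[of w t] by (auto simp: admissible_Cons weights_def algebra_simps)
      show "continuous_on {0..1} (\<lambda>t. ((1 - t) * w # t * w # map snd ps) ! i)" for i
        by (cases i; cases "i - 1") (auto intro!: continuous_intros)
    qed
    then have ch: "continuous_on {0..1} h" by (simp add: h_def m_def)
    \<comment> \<open>Rounding down keeps s k <= t, with an error of at most (1/2)^k.\<close>
    define p where "p = (\<lambda>k. nat \<lfloor>t * 2 ^ k\<rfloor>)"
    define s where "s = (\<lambda>k. real (p k) / 2 ^ k)"
    have p: "real (p k) \<le> t * 2 ^ k" "t * 2 ^ k - 1 \<le> real (p k)" for k
    proof -
      have "0 \<le> t * 2 ^ k" using t(1) by simp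
      then show "real (p k) \<le> t * 2 ^ k" "t * 2 ^ k - 1 \<le> real (p k)"
        unfolding p_def by linarith+
    qed
    have s: "0 \<le> s k" "s k \<le> t" "t - (1/2) ^ k \<le> s k" for k
    proof -
      have "t - (1/2) ^ k = (t * 2 ^ k - 1) / 2 ^ k" by (simp add: diff_divide_distrib power_divide)
      also have "\<dots> \<le> s k" unfolding s_def using p(2)[of k] by (intro divide_right_mono) auto
      finally show "t - (1/2) ^ k \<le> s k" .
    qed (use p[of k] in \<open>auto simp: s_def field_simps\<close>)
    have lim: "s \<longlonglongrightarrow> t"
    proof (rule real_tendsto_sandwich)
      have "(\<lambda>k. t - (1/2) ^ k) \<longlonglongrightarrow> t - 0" by (intro tendsto_intros) auto
      then show "(\<lambda>k. t - (1/2) ^ k) \<longlonglongrightarrow> t" by simp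
    qed (use s in auto)
    have "(\<lambda>k. h (s k)) \<longlonglongrightarrow> h t"
      by (rule continuous_on_tendsto_compose[OF ch lim])
        (use s t in \<open>auto intro!: always_eventually intro: order_trans[of _ t 1]\<close>)
    moreover have "h (s k) \<le> m (((1 - t) * a + t * b, w) # ps)" for k
    proof -
      have "t * 2 ^ k \<le> 2 ^ k" using t(2) by simp
      then have "real (p k) \<le> 2 ^ k" using p(1)[of k] by linarith
      then have "p k \<le> 2 ^ k" by (metis of_nat_le_iff of_nat_numeral of_nat_power)
      then have "h (s k) \<le> m (((1 - s k) * a + s k * b, w) # ps)"
        using m_split_dyadic[OF _ adm b] by (simp add: h_def s_def)
      also have "\<dots> \<le> m (((1 - t) * a + t * b, w) # ps)"
      proof (rule m_mono_head)
        have "(1 - s k) * a + s k * b \<in> I" "(1 - t) * a + t * b \<in> I"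
          using convex_combination_mem a b s[of k] t by auto
        then show "admissible I (((1 - s k) * a + s k * b, w) # ps)" "(1 - t) * a + t * b \<in> I"
          using adm by (auto simp: admissible_Cons)
        have "0 \<le> (t - s k) * (b - a)" using s[of k] ab by simp
        then show "(1 - s k) * a + s k * b \<le> (1 - t) * a + t * b" by (simp add: algebra_simps)
      qed
      finally show ?thesis .
    qed
    ultimately have "h t \<le> m (((1 - t) * a + t * b, w) # ps)"
      by (intro LIMSEQ_le_const2[of "\<lambda>k. h (s k)"]) auto
    then show ?thesis by (simp add: h_def)
  qed
  show ?thesis
  proof (cases "a \<le> b")
    case True
    then show ?thesis using * assms by blast
  next
    case False
    have a: "a \<in> I" "0 \<le> w" using adm by (auto simp: admissible_Cons)
    have "admissible I ((b, w) # ps)" using adm b by (auto simp: admissible_Cons)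
    then have "m ((b, t * w) # (a, (1 - t) * w) # ps) \<le> m ((t * b + (1 - t) * a, w) # ps)"
      using *[of b a "1 - t"] a t False by simp
    moreover have "m ((b, t * w) # (a, (1 - t) * w) # ps) = m ((a, (1 - t) * w) # (b, t * w) # ps)"
      using adm b a t mult_left_le_one_le[of w t] by (intro m_mset) (auto simp: admissible_Cons algebra_simps)
    ultimately show ?thesis by (simp add: add.commute)
  qed
qed

text \<open>One use of \<open>m_split\<close> for each index. The extra list \<open>ps\<close>
  serves the induction: it holds the split pair of the head while the tail is treated.\<close>

lemma m_split_all:
  assumes "\<And>i. i \<in> set is \<Longrightarrow> a i \<in> I \<and> b i \<in> I \<and> 0 \<le> t i \<and> t i \<le> 1 \<and> 0 \<le> w i"
    and "0 < (\<Sum>i\<leftarrow>is. w i) + (\<Sum>p\<leftarrow>ps. snd p)" "fst ` set ps \<subseteq> I" "\<forall>p\<in>set ps. 0 \<le> snd p"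
  shows "m (concat (map (\<lambda>i. [(a i, (1 - t i) * w i), (b i, t i * w i)]) is) @ ps)
    \<le> m (map (\<lambda>i. ((1 - t i) * a i + t i * b i, w i)) is @ ps)"
  using assms
proof (induction "is" arbitrary: ps)
  case (Cons i js)
  let ?S = "\<lambda>js. concat (map (\<lambda>i. [(a i, (1 - t i) * w i), (b i, t i * w i)]) js)"
  let ?T = "\<lambda>js. map (\<lambda>i. ((1 - t i) * a i + t i * b i, w i)) js"
  have i: "a i \<in> I" "b i \<in> I" "0 \<le> t i" "t i \<le> 1" "0 \<le> w i" using Cons.prems(1) by auto
  have c: "(1 - t j) * a j + t j * b j \<in> I" if "j \<in> set (i # js)" for j
    using Cons.prems(1)[OF that] by (intro convex_combination_mem) auto
  have tw: "(1 - t i) * w i + t i * w i = w i" "0 \<le> (1 - t i) * w i" "0 \<le> t i * w i"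
    using i by (auto simp: algebra_simps mult_left_le_one_le)
  have T: "fst ` set (?T js) \<subseteq> I" "\<forall>p\<in>set (?T js). 0 \<le> snd p" "(\<Sum>p\<leftarrow>?T js. snd p) = (\<Sum>i\<leftarrow>js. w i)"
    using c Cons.prems(1) by (auto simp: o_def)
  have S: "fst ` set (?S js) \<subseteq> I" "\<forall>p\<in>set (?S js). 0 \<le> snd p"
    using Cons.prems(1) by (auto simp: mult_nonneg_nonneg)
  have Ss: "(\<Sum>p\<leftarrow>?S js. snd p) = (\<Sum>i\<leftarrow>js. w i)"
    by (induction js) (auto simp: algebra_simps)
  let ?qs = "(a i, (1 - t i) * w i) # (b i, t i * w i) # ps"
  have q: "0 < (\<Sum>i\<leftarrow>js. w i) + (\<Sum>p\<leftarrow>?qs. snd p)"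
    using Cons.prems(2) tw by simp
  have "m (?S (i # js) @ ps) = m (?S js @ ?qs)"
    using i S Ss Cons.prems tw by (intro m_mset) (auto simp: admissible_Cons)
  also have "\<dots> \<le> m (?T js @ ?qs)"
    using Cons.prems i tw q by (intro Cons.IH) auto
  also have "\<dots> = m ((a i, (1 - t i) * w i) # (b i, t i * w i) # ?T js @ ps)"
    using i T Cons.prems tw q by (intro m_mset) (auto simp: admissible_def)
  also have "\<dots> \<le> m (((1 - t i) * a i + t i * b i, w i) # ?T js @ ps)"
    using i T Cons.prems by (intro m_split) (auto simp: admissible_Cons)
  finally show ?case by simp
qed simp

section \<open>Concavity and scaling in the values\<close>

lemma M_mem: "x \<in> points I n \<Longrightarrow> w \<in> weights n \<Longrightarrow> M x w \<in> I"
  using mean unfolding weighted_mean_def by simp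

text \<open>Along the segment from x to y the mean is midpoint concave and bounded below by 0, so
  \<open>midpoint_concave_chord\<close> applies.\<close>

lemma M_concave:
  assumes x: "x \<in> points I n" and y: "y \<in> points I n" and w: "w \<in> weights n" and s: "0 \<le> s" "s \<le> 1"
  shows "(1 - s) * M x w + s * M y w \<le> M (map2 (\<lambda>a b. (1 - s) * a + s * b) x y) w"
proof -
  define z where "z = (\<lambda>u. map2 (\<lambda>a b. (1 - u) * a + u * b) x y)"
  have len: "length x = n" "length y = n" using x y by (auto simp: points_def)
  have z: "z u \<in> points I n" if "u \<in> {0..1}" for u
    using x y that by (auto simp: z_def points_def intro!: convex_combination_mem dest: set_zip_leftD set_zip_rightD)
  have "(1 - s) * M (z 0) w + s * M (z 1) w \<le> M (z s) w"
  proof (rule midpoint_concave_chord)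
    fix u v :: real assume uv: "u \<in> {0..1}" "v \<in> {0..1}"
    have "map2 (\<lambda>a b. (a + b) / 2) (z u) (z v) = z ((u + v) / 2)"
      using len by (intro nth_equalityI) (auto simp: z_def field_simps)
    then show "(M (z u) w + M (z v) w) / 2 \<le> M (z ((u + v) / 2)) w"
      using jensen z uv w unfolding jensen_concave_mean_def by metis
    show "0 \<le> M (z u) w"
      using M_mem[OF z[OF uv(1)] w] nonneg by auto
  qed (use s in auto)
  moreover have "z 0 = x" "z 1 = y" using len by (auto simp: z_def intro!: nth_equalityI)
  ultimately show ?thesis by (simp add: z_def)
qed

lemma mem_smaller: "a \<in> I \<Longrightarrow> 0 < u \<Longrightarrow> u \<le> a \<Longrightarrow> u \<in> I"
  using small[of u] interval by (meson is_interval_1 less_imp_le)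

lemma mem_scale: "a \<in> I \<Longrightarrow> 0 < t \<Longrightarrow> t \<le> 1 \<Longrightarrow> t * a \<in> I"
  using mem_smaller[of a "t * a"] nonneg mult_left_le_one_le[of a t] by (cases "a = 0") (auto simp: less_le)

lemma M_nonneg: "x \<in> points I n \<Longrightarrow> w \<in> weights n \<Longrightarrow> 0 \<le> M x w"
  using M_mem nonneg by auto

text \<open>If 0 is in I, this is concavity between x and the zero vector. In general, for r < t,
  the zero vector is replaced by a constant e in I so small that r x + (1 - r) e <= t x in every
  coordinate; then r is let tend to t.\<close>

lemma M_scale:
  assumes x: "x \<in> points I n" and w: "w \<in> weights n" and t: "0 < t" "t \<le> 1"
  shows "t * M x w \<le> M (map (\<lambda>a. t * a) x) w"
proof -
  have len: "length x = n" "set x \<subseteq> I" using x by (auto simp: points_def)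
  have "n \<noteq> 0" using w by (auto simp: weights_def)
  then have ne: "set x \<noteq> {}" using len by auto
  have tx: "map (\<lambda>a. t * a) x \<in> points I n"
    using len t by (auto simp: points_def intro!: mem_scale)
  have *: "r * M x w \<le> M (map (\<lambda>a. t * a) x) w" if r: "0 < r" "r < t" for r
  proof -
    have "\<exists>e\<in>I. \<forall>a\<in>set x. e \<le> (t - r) * a"
    proof (cases "0 \<in> I")
      case True
      then show ?thesis using r len nonneg by (intro bexI[of _ 0]) auto
    next
      case False
      have "Min (set x) \<in> I" using ne len by (meson List.finite_set Min_in subsetD)
      then have "0 < Min (set x)" using False nonneg by (metis atLeast_iff less_le subsetD)
      then obtain e where e: "e \<in> I" "e < (t - r) * Min (set x)"
        using small[of "(t - r) * Min (set x)"] r by auto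
      have "e \<le> (t - r) * a" if "a \<in> set x" for a
      proof -
        have "(t - r) * Min (set x) \<le> (t - r) * a" using r that by (intro mult_left_mono) auto
        then show ?thesis using e by linarith
      qed
      then show ?thesis using e by blast
    qed
    then obtain e where e: "e \<in> I" "\<And>a. a \<in> set x \<Longrightarrow> e \<le> (t - r) * a" by blast
    let ?y = "replicate n e"
    let ?z = "map2 (\<lambda>a b. (1 - (1 - r)) * a + (1 - r) * b) x ?y"
    have y: "?y \<in> points I n" using e by (auto simp: points_def)
    have z: "?z \<in> points I n"
      using len e r t by (auto simp: points_def intro!: convex_combination_mem[of _ _ "1 - r", simplified]
          dest: set_zip_leftD set_zip_rightD)
    have "r * M x w \<le> (1 - (1 - r)) * M x w + (1 - r) * M ?y w"
      using M_nonneg[OF y w] r t by simp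
    also have "\<dots> \<le> M ?z w" using r t by (intro M_concave[OF x y w]) auto
    also have "\<dots> \<le> M (map (\<lambda>a. t * a) x) w"
    proof (rule M_mono[OF z tx w])
      fix i assume i: "i < n"
      have "0 \<le> e" using e nonneg by auto
      then have "(1 - r) * e \<le> e" using r t by (intro mult_left_le_one_le) auto
      also have "e \<le> (t - r) * x ! i" using e(2)[of "x ! i"] i len by auto
      finally show "?z ! i \<le> map (\<lambda>a. t * a) x ! i" using i len by (simp add: algebra_simps)
    qed
    finally show ?thesis .
  qed
  show ?thesis
  proof (cases "M x w = 0")
    case True
    then show ?thesis using M_nonneg[OF tx w] by simp
  next
    case False
    then have pos: "0 < M x w" using M_nonneg[OF x w] by simp
    \<comment> \<open>The bound holds for every r < t, hence for t by density.\<close>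
    have "t \<le> M (map (\<lambda>a. t * a) x) w / M x w"
      by (rule dense_le_bounded[OF t(1)]) (use * pos in \<open>simp add: pos_le_divide_eq\<close>)
    then show ?thesis using pos by (simp add: pos_le_divide_eq)
  qed
qed

end

section \<open>Weight sequences\<close>

lemma psum_Suc: "psum l (Suc n) = psum l n + l (Suc n)"
  and psum_0: "psum l 0 = l 0"
  by (simp_all add: psum_def)

lemma psum_eq: "psum l n = (\<Sum>i<Suc n. l i)"
  by (simp add: psum_def lessThan_Suc_atMost)

definition average :: "(nat \<Rightarrow> real) \<Rightarrow> (nat \<Rightarrow> real) \<Rightarrow> nat \<Rightarrow> real" where
  "average l x n = (\<Sum>i\<le>n. l i * x i) / psum l n"

lemma sum_atMost_split:
  fixes f :: "nat \<Rightarrow> real"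
  assumes "m \<le> n"
  shows "sum f {..n} = sum f {..m} + sum f {m<..n}"
proof -
  have "{..n} = {..m} \<union> {m<..n}" using assms by auto
  then show ?thesis by (metis finite_atMost finite_greaterThanAtMost ivl_disj_int_one(3) sum.union_disjoint)
qed

locale hardy_weights =
  fixes l :: "nat \<Rightarrow> real"
  assumes V: "l \<in> V_weights"
begin

lemma l_nonneg: "0 \<le> l n" and l0: "0 < l 0"
  using V by (auto simp: V_weights_def)

lemma psum_pos: "0 < psum l n"
  unfolding psum_def by (rule sum_pos2[of _ 0]) (use l0 l_nonneg in auto)

lemma psum_mono: "m \<le> n \<Longrightarrow> psum l m \<le> psum l n"
  unfolding psum_def by (rule sum_mono2) (use l_nonneg in auto)

lemma ratio_antimono: "m \<le> n \<Longrightarrow> l n / psum l n \<le> l m / psum l m"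
  using V by (auto simp: V_weights_def decseq_def)

text \<open>A vanishing ratio forces all later ratios to vanish. This secures the division by
  \<open>l i\<close> in \<open>shift\<close> whenever \<open>l (Suc N)\<close> is positive.\<close>

lemma l_pos_le:
  assumes "0 < l n" "m \<le> n"
  shows "0 < l m"
proof -
  have "0 < l n / psum l n" using assms(1) psum_pos[of n] by simp
  then have "0 < l m / psum l m" using ratio_antimono[OF assms(2)] by linarith
  then show ?thesis using psum_pos[of m] by (simp add: zero_less_divide_iff)
qed

lemma average_0: "average l x 0 = x 0"
  using l0 by (simp add: average_def psum_0)

lemma psum_average: "psum l n * average l x n = (\<Sum>i\<le>n. l i * x i)"
  using psum_pos[of n] by (simp add: average_def)

lemma psum_average_Suc:
  "psum l (Suc n) * average l x (Suc n) = psum l n * average l x n + l (Suc n) * x (Suc n)"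
  unfolding psum_average by simp

text \<open>These are the t_i of the overview. At i = 0 the preceding partial sum is empty, hence
  the value 0, which also makes the truncated index \<open>i - 1\<close> harmless.\<close>

definition shift :: "nat \<Rightarrow> nat \<Rightarrow> real" where
  "shift N i = (if i = 0 then 0 else l (Suc N) / psum l N * (psum l (i - 1) / l i))"

text \<open>Cross-multiplying the ratio condition for i and Suc N, the common product of the two
  weights cancels, which leaves the upper bound 1.\<close>

lemma shift_bounds:
  assumes "i \<le> Suc N" "0 < l (Suc N)"
  shows "0 \<le> shift N i" "shift N i \<le> 1"
proof -
  show "0 \<le> shift N i" using l_nonneg psum_pos by (auto simp: shift_def less_imp_le)
  show "shift N i \<le> 1"
  proof (cases i)
    case (Suc j)
    have li: "0 < l i" using l_pos_le assms by blast
    have "l (Suc N) / (psum l N + l (Suc N)) \<le> l i / (psum l j + l i)"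
      using ratio_antimono[OF assms(1)] Suc by (simp add: psum_Suc)
    then have "l (Suc N) * (psum l j + l i) \<le> l i * (psum l N + l (Suc N))"
      using psum_pos[of j] psum_pos[of N] li assms(2) by (simp add: field_simps)
    then have "l (Suc N) * psum l j \<le> l i * psum l N" by (simp add: algebra_simps)
    then show ?thesis using psum_pos[of N] li Suc by (simp add: shift_def field_simps)
  qed (simp add: shift_def)
qed

text \<open>With j = i - 1, L_j (A_i - A_j) = l_i (x_i - A_i), since both sides measure the effect
  of adding x_i to the average. The factor in \<open>shift\<close> turns this into L_N t_i (A_i -
  A_j) = l_(N+1) (x_i - A_i).\<close>

lemma average_recursion:
  assumes "i \<le> Suc N" "0 < l (Suc N)"
  shows "psum l (Suc N) * average l x i = l (Suc N) * x i +
    psum l N * ((1 - shift N i) * average l x i + shift N i * average l x (i - 1))"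
proof (cases i)
  case 0
  then show ?thesis by (simp add: shift_def average_0 psum_Suc algebra_simps)
next
  case (Suc j)
  let ?A = "average l x"
  have li: "0 < l i" using l_pos_le assms by blast
  have "psum l N * shift N i = l (Suc N) * psum l j / l i"
    using psum_pos[of N] Suc by (simp add: shift_def)
  then have "psum l N * shift N i * (?A i - ?A j) = l (Suc N) * (psum l j * (?A i - ?A j)) / l i"
    by simp
  also have "psum l j * (?A i - ?A j) = l i * (x i - ?A i)"
    using psum_average_Suc[of j x] Suc by (simp add: psum_Suc algebra_simps)
  finally have "psum l N * shift N i * (?A i - ?A j) = l (Suc N) * (x i - ?A i)"
    using li by simp
  then show ?thesis using Suc by (simp add: psum_Suc algebra_simps)
qed

text \<open>Summation by parts: the mass moved from i + 1 to i is c L_i with c = l_(N+1) / L_N. As c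
  L_N = l_(N+1), the last point loses all its mass, and the others keep weights proportional to l
  with factor 1 + c = L_(N+1) / L_N.\<close>

lemma shift_law:
  assumes "0 < l (Suc N)"
  shows "(\<Sum>i<Suc (Suc N). (1 - shift N i) * l i * f i + shift N i * l i * f (i - 1))
    = psum l (Suc N) / psum l N * (\<Sum>i<Suc N. l i * (f i :: real))"
proof -
  have abel: "(\<Sum>i<Suc n. psum l i * (f (Suc i) - f i)) = psum l n * f (Suc n) - (\<Sum>i<Suc n. l i * f i)" for n
    by (induction n) (simp_all add: psum_0 psum_Suc algebra_simps)
  let ?c = "l (Suc N) / psum l N"
  have t: "shift N (Suc i) * l (Suc i) = ?c * psum l i" if "i \<le> N" for i
    using l_pos_le[OF assms, of "Suc i"] that by (simp add: shift_def)
  have "(\<Sum>i<Suc (Suc N). (1 - shift N i) * l i * f i + shift N i * l i * f (i - 1))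
      = (\<Sum>i<Suc (Suc N). l i * f i) - (\<Sum>i<Suc (Suc N). shift N i * l i * (f i - f (i - 1)))"
    unfolding sum_subtractf[symmetric] by (intro sum.cong) (auto simp: algebra_simps)
  also have "(\<Sum>i<Suc (Suc N). shift N i * l i * (f i - f (i - 1)))
      = (\<Sum>i<Suc N. shift N (Suc i) * l (Suc i) * (f (Suc i) - f i))"
    by (subst sum.lessThan_Suc_shift) (simp add: shift_def)
  also have "\<dots> = ?c * (\<Sum>i<Suc N. psum l i * (f (Suc i) - f i))"
    unfolding sum_distrib_left by (intro sum.cong refl) (use t in auto)
  also have "\<dots> = ?c * (psum l N * f (Suc N) - (\<Sum>i<Suc N. l i * f i))" by (simp only: abel)
  also have "(\<Sum>i<Suc (Suc N). l i * f i) - \<dots> = psum l (Suc N) / psum l N * (\<Sum>i<Suc N. l i * f i)"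
    using psum_pos[of N] by (simp add: psum_Suc field_simps)
  finally show ?thesis .
qed

end

section \<open>The Kedlaya inequality and the Hardy constant\<close>

locale weighted_hardy_mean = hardy_mean + hardy_weights
begin

lemma upto_points: "(\<And>i. i \<le> n \<Longrightarrow> x i \<in> I) \<Longrightarrow> upto_term x n \<in> points I (Suc n)"
  by (auto simp: upto_term_def points_def)

lemma upto_weights: "upto_term l n \<in> weights (Suc n)"
proof -
  have "sum_list (upto_term l n) = psum l n"
    by (simp add: upto_term_def psum_eq interv_sum_list_conv_sum_set_nat atLeast0LessThan del: upt_Suc)
  then show ?thesis using l_nonneg psum_pos[of n] by (auto simp: weights_def upto_term_def)
qed

lemma average_mem:
  assumes "\<And>i. i \<le> n \<Longrightarrow> x i \<in> I"
  shows "average l x n \<in> I"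
proof -
  have "convex I" using interval is_interval_convex by blast
  moreover have "average l x n = (\<Sum>i\<le>n. (l i / psum l n) *\<^sub>R x i)"
    by (simp add: average_def sum_divide_distrib)
  moreover have "(\<Sum>i\<le>n. l i / psum l n) = 1"
    using psum_pos[of n] by (simp add: psum_def flip: sum_divide_distrib)
  ultimately show ?thesis
    using convex_sum[of "{..n}" I "\<lambda>i. l i / psum l n" x] assms l_nonneg psum_pos[of n] by simp
qed

lemma m_upt: "m (map (\<lambda>i. (x i, w i)) [0..<Suc n]) = M (upto_term x n) (upto_term w n)"
  by (simp add: m_def upto_term_def o_def del: upt_Suc)

text \<open>By \<open>shift_law\<close> the left mean, with weights scaled by c, is the mean of the
  split distribution; gathering every pair at its barycentre does not decrease it.\<close>

lemma kedlaya_step: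
  assumes pos: "0 < l (Suc N)" and A: "\<And>i. A i \<in> I"
  shows "M (upto_term A N) (upto_term l N)
    \<le> M (upto_term (\<lambda>i. (1 - shift N i) * A i + shift N i * A (i - 1)) (Suc N)) (upto_term l (Suc N))"
proof -
  define c where "c = psum l (Suc N) / psum l N"
  have c: "0 < c" using psum_pos by (simp add: c_def)
  let ?S = "concat (map (\<lambda>i. [(A i, (1 - shift N i) * l i), (A (i - 1), shift N i * l i)]) [0..<Suc (Suc N)])"
  let ?P = "map (\<lambda>i. (A i, c * l i)) [0..<Suc N]"
  have ws: "weighted_sum ?S f = weighted_sum ?P f" for f
    unfolding weighted_sum_split_upt weighted_sum_upt
    using shift_law[OF pos, of "\<lambda>i. f (A i)"] by (simp only: c_def sum_distrib_left mult.assoc)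
  have P: "admissible I ?P"
    using A c l_nonneg psum_pos[of N] by (intro admissible_upt) (auto simp: psum_eq simp flip: sum_distrib_left)
  have "admissible I ?S"
    using P ws[of "\<lambda>_. 1"] A shift_bounds[OF _ pos] l_nonneg
    by (auto simp: admissible_def weighted_sum_def simp del: upt_Suc)
  then have "m ?S = m ?P" using P ws by (rule m_cong_law)
  moreover have "m ?P = M (upto_term A N) (map (\<lambda>t. c * t) (upto_term l N))"
    by (simp add: m_def upto_term_def o_def del: upt_Suc)
  moreover have "M (upto_term A N) (map (\<lambda>t. c * t) (upto_term l N)) = M (upto_term A N) (upto_term l N)"
    using mean upto_points[of N A] A upto_weights[of N] c unfolding weighted_mean_def by metis
  moreover have "m (?S @ []) \<le> m (map (\<lambda>i. ((1 - shift N i) * A i + shift N i * A (i - 1), l i)) [0..<Suc (Suc N)] @ [])"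
    using A shift_bounds[OF _ pos] l_nonneg psum_pos[of "Suc N"]
    by (intro m_split_all) (auto simp: psum_eq interv_sum_list_conv_sum_set_nat atLeast0LessThan simp del: upt_Suc)
  ultimately show ?thesis by (simp add: m_upt del: upt_Suc)
qed

lemma kedlaya:
  assumes x: "\<And>i. x i \<in> I"
  shows "(\<Sum>n\<le>N. l n * M (upto_term x n) (upto_term l n))
    \<le> psum l N * M (upto_term (average l x) N) (upto_term l N)"
proof (induction N)
  case 0
  then show ?case by (simp add: psum_0 upto_term_def average_0)
next
  case (Suc N)
  let ?A = "average l x"
  have A: "?A i \<in> I" for i using average_mem x by blast
  show ?case
  proof (cases "l (Suc N) = 0")
    case True
    \<comment> \<open>A vanishing weight contributes no summand on the left and no mass to the mean
      on the right.\<close>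
    have "m (map (\<lambda>i. (?A i, l i)) [0..<Suc (Suc N)]) = m (map (\<lambda>i. (?A i, l i)) [0..<Suc N])"
      using A l_nonneg psum_pos[of N] psum_pos[of "Suc N"] True
      by (intro m_cong_law admissible_upt) (auto simp: psum_eq weighted_sum_upt simp del: upt_Suc)
    then show ?thesis using Suc True by (simp add: m_upt psum_Suc del: upt_Suc)
  next
    case False
    then have pos: "0 < l (Suc N)" using l_nonneg[of "Suc N"] by simp
    let ?B = "\<lambda>i. (1 - shift N i) * ?A i + shift N i * ?A (i - 1)"
    \<comment> \<open>With this ratio, \<open>average_recursion\<close> says that the averages are
      the combination of \<open>?B\<close> and x with weights 1 - s and s, so concavity
      applies.\<close>
    define s where "s = l (Suc N) / psum l (Suc N)"
    have s: "0 \<le> s" "s \<le> 1" "psum l (Suc N) * s = l (Suc N)" "psum l (Suc N) * (1 - s) = psum l N"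
      using pos psum_pos[of "Suc N"] psum_pos[of N] by (auto simp: s_def field_simps psum_Suc)
    have B: "?B i \<in> I" if "i \<le> Suc N" for i
      using A shift_bounds[OF that pos] by (intro convex_combination_mem)
    have "map2 (\<lambda>a b. (1 - s) * a + s * b) (upto_term ?B (Suc N)) (upto_term x (Suc N)) = upto_term ?A (Suc N)"
    proof (rule nth_equalityI)
      fix i assume "i < length (map2 (\<lambda>a b. (1 - s) * a + s * b) (upto_term ?B (Suc N)) (upto_term x (Suc N)))"
      then have i: "i \<le> Suc N" by (simp add: upto_term_def)
      have "psum l (Suc N) * ((1 - s) * ?B i + s * x i) = psum l N * ?B i + l (Suc N) * x i"
        unfolding s(3,4)[symmetric] by (simp add: algebra_simps)
      also have "\<dots> = psum l (Suc N) * ?A i" using average_recursion[OF i pos, of x] by simp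
      finally have "(1 - s) * ?B i + s * x i = ?A i" using psum_pos[of "Suc N"] by simp
      then show "map2 (\<lambda>a b. (1 - s) * a + s * b) (upto_term ?B (Suc N)) (upto_term x (Suc N)) ! i = upto_term ?A (Suc N) ! i"
        using i by (simp add: upto_term_def del: upt_Suc)
    qed (simp add: upto_term_def)
    then have conc: "(1 - s) * M (upto_term ?B (Suc N)) (upto_term l (Suc N)) +
        s * M (upto_term x (Suc N)) (upto_term l (Suc N)) \<le> M (upto_term ?A (Suc N)) (upto_term l (Suc N))"
      using M_concave[OF upto_points upto_points upto_weights s(1,2), of "Suc N" ?B x] B x by simp
    let ?M = "M (upto_term x (Suc N)) (upto_term l (Suc N))"
    have "(\<Sum>n\<le>Suc N. l n * M (upto_term x n) (upto_term l n))
        \<le> psum l N * M (upto_term ?A N) (upto_term l N) + l (Suc N) * ?M"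
      using Suc by simp
    also have "\<dots> \<le> psum l N * M (upto_term ?B (Suc N)) (upto_term l (Suc N)) + l (Suc N) * ?M"
      using kedlaya_step[OF pos A] psum_pos[of N] by simp
    also have "\<dots> = psum l (Suc N) * ((1 - s) * M (upto_term ?B (Suc N)) (upto_term l (Suc N)) + s * ?M)"
      unfolding s(3,4)[symmetric] by (simp add: algebra_simps)
    also have "\<dots> \<le> psum l (Suc N) * M (upto_term ?A (Suc N)) (upto_term l (Suc N))"
      using conc psum_pos[of "Suc N"] by simp
    finally show ?thesis .
  qed
qed

section \<open>Upper bound for the Hardy constant\<close>

definition C_seq :: "real \<Rightarrow> nat \<Rightarrow> real" where
  "C_seq y n = psum l n / y * M (upto_term (\<lambda>k. y / psum l k) n) (upto_term l n)"

definition C_domain :: "real set" where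
  "C_domain = {y. 0 < y \<and> (\<forall>n. y / psum l n \<in> I)}"

lemma C_constant_eq: "C_constant I M l = (SUP y\<in>C_domain. liminf (\<lambda>n. ereal (C_seq y n)))"
  by (simp add: C_constant_def C_domain_def C_seq_def)

text \<open>The partial sums increase, so the last value y / L_n is the least one and bounds the
  mean from below.\<close>

lemma C_seq_ge_1:
  assumes "y \<in> C_domain"
  shows "1 \<le> C_seq y n"
proof -
  have y: "0 < y" "\<And>n. y / psum l n \<in> I" using assms by (auto simp: C_domain_def)
  let ?x = "upto_term (\<lambda>k. y / psum l k) n"
  have "y / psum l n \<le> Min (set ?x)"
    using y(1) psum_pos psum_mono by (subst Min_ge_iff) (auto simp: upto_term_def intro!: divide_left_mono)
  also have "\<dots> \<le> M ?x (upto_term l n)"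
    using y(2) by (intro mean_between(1)[OF mean upto_points upto_weights])
  finally show ?thesis using y(1) psum_pos[of n] by (simp add: C_seq_def field_simps)
qed

lemma liminf_ge_1:
  assumes "y \<in> C_domain"
  shows "1 \<le> liminf (\<lambda>n. ereal (C_seq y n))"
  using C_seq_ge_1[OF assms] by (intro Liminf_bounded always_eventually) simp

text \<open>The largest of the values is y / l 0, so it is enough that this one does not exceed
  a.\<close>

lemma C_domainI:
  assumes "a \<in> I" "0 < y" "y \<le> a * l 0"
  shows "y \<in> C_domain"
  unfolding C_domain_def
proof (intro CollectI conjI allI mem_smaller[OF assms(1)])
  fix n
  have "0 \<le> a" using assms nonneg by auto
  then have "a * l 0 \<le> a * psum l n"
    using psum_mono[of 0 n] by (intro mult_left_mono) (auto simp: psum_0)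
  then show "y / psum l n \<le> a" using assms psum_pos[of n] by (simp add: pos_divide_le_eq)
qed (use assms psum_pos in auto)

text \<open>After \<open>kedlaya\<close>, A_k <= S / L_k would suffice, but S / L_k may lie outside
  I. The factor t brings the points into I by \<open>M_scale\<close>, and it cancels against the y =
  t S in the denominator of \<open>C_seq\<close>.\<close>

lemma partial_sum_le:
  assumes x: "\<And>n. x n \<in> I" and S: "0 < S" "\<And>n. (\<Sum>i\<le>n. l i * x i) \<le> S"
    and t: "0 < t" "t \<le> 1" and y: "t * S \<in> C_domain"
  shows "(\<Sum>n\<le>N. l n * M (upto_term x n) (upto_term l n)) \<le> S * C_seq (t * S) N"
proof -
  let ?A = "average l x" and ?w = "upto_term l N" and ?z = "\<lambda>k. t * S / psum l k"
  have A: "upto_term ?A N \<in> points I (Suc N)" using x average_mem by (intro upto_points) auto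
  have tA: "map (\<lambda>a. t * a) (upto_term ?A N) \<in> points I (Suc N)"
    using A t by (auto simp: points_def intro!: mem_scale)
  have z: "upto_term ?z N \<in> points I (Suc N)"
    using y by (intro upto_points) (auto simp: C_domain_def)
  have "t * M (upto_term ?A N) ?w \<le> M (map (\<lambda>a. t * a) (upto_term ?A N)) ?w"
    using M_scale[OF A upto_weights t] .
  also have "\<dots> \<le> M (upto_term ?z N) ?w"
  proof (rule M_mono[OF tA z upto_weights])
    fix i assume i: "i < Suc N"
    have "t * ?A i \<le> ?z i"
      using t S(2)[of i] psum_pos[of i] by (simp add: average_def divide_right_mono)
    then show "map (\<lambda>a. t * a) (upto_term ?A N) ! i \<le> upto_term ?z N ! i"
      using i by (simp add: upto_term_def del: upt_Suc)
  qed
  finally have le: "t * M (upto_term ?A N) ?w \<le> M (upto_term ?z N) ?w" .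
  have "(\<Sum>n\<le>N. l n * M (upto_term x n) (upto_term l n)) \<le> psum l N * M (upto_term ?A N) ?w"
    using kedlaya[of x] x by blast
  also have "\<dots> = psum l N / t * (t * M (upto_term ?A N) ?w)" using t by simp
  also have "\<dots> \<le> psum l N / t * M (upto_term ?z N) ?w"
    using le t psum_pos[of N] by (intro mult_left_mono) auto
  also have "\<dots> = S * C_seq (t * S) N" using S t by (simp add: C_seq_def)
  finally show ?thesis .
qed

lemma term_nonneg:
  assumes "\<And>n. x n \<in> I"
  shows "0 \<le> l n * x n" "0 \<le> l n * M (upto_term x n) (upto_term l n)"
proof -
  have "0 \<le> x n" using assms nonneg by auto
  then show "0 \<le> l n * x n" using l_nonneg by simp
  have "0 \<le> M (upto_term x n) (upto_term l n)"
    using assms by (intro M_nonneg[OF upto_points upto_weights])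
  then show "0 \<le> l n * M (upto_term x n) (upto_term l n)" using l_nonneg by simp
qed

lemma hardy_bound_C_constant: "hardy_bound I M l (C_constant I M l)"
  unfolding hardy_bound_def
proof (intro allI impI)
  fix x :: "nat \<Rightarrow> real" assume "\<forall>n. x n \<in> I"
  then have x: "\<And>n. x n \<in> I" by blast
  define S where "S = (\<Sum>n. ereal (l n * x n))"
  let ?C = "C_constant I M l" and ?T = "\<Sum>n. ereal (l n * M (upto_term x n) (upto_term l n))"
  have upper: "ereal (\<Sum>i\<le>n. l i * x i) \<le> S" for n
  proof -
    have "(\<Sum>i<Suc n. ereal (l i * x i)) \<le> S"
      unfolding S_def using term_nonneg[OF x] by (intro suminf_upper) auto
    then show ?thesis by (simp add: lessThan_Suc_atMost)
  qed
  have S0: "0 \<le> S" unfolding S_def using term_nonneg(1)[OF x] by (intro suminf_0_le) auto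
  have "?T \<le> ?C * S"
  proof (cases "S = 0")
    case True
    \<comment> \<open>This case stays apart also because \<open>C_domain\<close> is empty for I =
      {0}, where the supremum is -\<infinity>; here both sides are 0.\<close>
    have "l n * x n = 0" for n
    proof -
      have "l n * x n \<le> (\<Sum>i\<le>n. l i * x i)" using term_nonneg(1)[OF x] by (intro member_le_sum) auto
      also have "\<dots> \<le> 0" using upper[of n] True by simp
      finally show ?thesis using antisym term_nonneg(1)[of x n] x by blast
    qed
    then have "M (upto_term x n) (upto_term l n) = 0" for n
      using x by (intro mean_eq_0[OF mean nonneg upto_points upto_weights])
        (auto simp: upto_term_def simp del: upt_Suc)
    then show ?thesis using True by (simp flip: zero_ereal_def)
  next
    case False
    have "\<exists>n. x n \<noteq> 0"
    proof (rule ccontr)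
      assume "\<not> ?thesis"
      then have "x n = 0" for n by simp
      then show False using False by (simp add: S_def flip: zero_ereal_def)
    qed
    then obtain a where a: "a \<in> I" "0 < a" using x nonneg by (metis atLeast_iff less_le subsetD)
    show ?thesis
    proof (cases S)
      case (real s)
      have s: "0 < s" using False S0 real by (simp add: less_le zero_ereal_def)
      \<comment> \<open>Chosen so that t s <= a * l 0, as \<open>C_domainI\<close> requires.\<close>
      define t where "t = min 1 (a * l 0 / s)"
      have t: "0 < t" "t \<le> 1" using a l0 s by (auto simp: t_def)
      have "t * s \<le> a * l 0 / s * s" using s by (intro mult_right_mono) (auto simp: t_def)
      then have y: "t * s \<in> C_domain" using s t by (intro C_domainI[OF a(1)]) auto
      have "ereal (\<Sum>n\<le>N. l n * M (upto_term x n) (upto_term l n)) \<le> ?C * S" (is "ereal (?P N) \<le> _") for N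
      proof -
        \<comment> \<open>The partial sums increase, so the one at a fixed N is bounded through
          every later n, and the lower limit may be taken.\<close>
        have "eventually (\<lambda>n. ereal (?P N / s) \<le> ereal (C_seq (t * s) n)) sequentially"
          using eventually_ge_at_top[of N]
        proof eventually_elim
          case (elim n)
          have "?P N \<le> ?P n" using elim term_nonneg(2)[OF x] by (intro sum_mono2) auto
          also have "\<dots> \<le> s * C_seq (t * s) n"
            using upper real x by (intro partial_sum_le[OF _ s _ t y]) auto
          finally show ?case using s by (simp add: field_simps)
        qed
        then have "ereal (?P N / s) \<le> liminf (\<lambda>n. ereal (C_seq (t * s) n))" by (rule Liminf_bounded)
        also have "\<dots> \<le> ?C" unfolding C_constant_eq using y by (rule SUP_upper)
        finally have "ereal (?P N / s) * ereal s \<le> ?C * ereal s"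
          using s by (intro ereal_mult_right_mono) auto
        then show ?thesis using s real by simp
      qed
      then have part: "ereal (?P N) \<le> ?C * S" for N by blast
      show ?thesis
      proof (rule suminf_bound[OF allI])
        fix n
        have "(\<Sum>i<n. l i * M (upto_term x i) (upto_term l i)) \<le> ?P n"
          using term_nonneg(2)[OF x] by (intro sum_mono2) auto
        then show "(\<Sum>i<n. ereal (l i * M (upto_term x i) (upto_term l i))) \<le> ?C * S"
          using order_trans[OF _ part[of n]] by simp
      qed (use term_nonneg(2)[OF x] in auto)
    next
      case PInf
      \<comment> \<open>The constant is at least 1, so the right-hand side is infinite.\<close>
      have "a * l 0 \<in> C_domain" using a l0 by (intro C_domainI[OF a(1)]) auto
      then have "1 \<le> ?C" unfolding C_constant_eq by (intro SUP_upper2[of "a * l 0"] liminf_ge_1)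
      then have "0 < ?C" by (rule less_le_trans[rotated]) simp
      then show ?thesis using PInf by (simp add: less_imp_neq[THEN not_sym])
    qed (use S0 in auto)
  qed
  then show "?T \<le> ?C * (\<Sum>n. ereal (l n * x n))" by (simp add: S_def)
qed

section \<open>Lower bound for weights of infinite sum\<close>

lemma psum_unbounded:
  assumes "(\<Sum>n. ereal (l n)) = \<infinity>"
  shows "\<exists>n. K < psum l n"
proof (rule ccontr)
  assume "\<not> ?thesis"
  then have K: "psum l n \<le> K" for n by (simp add: not_less)
  have "(\<Sum>n. ereal (l n)) \<le> ereal K"
  proof (rule suminf_bound[OF allI])
    fix n
    have "(\<Sum>i<n. l i) \<le> psum l n" unfolding psum_def using l_nonneg by (intro sum_mono2) auto
    then show "(\<Sum>i<n. ereal (l i)) \<le> ereal K" using K[of n] by simp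
  qed (use l_nonneg in auto)
  then show False using assms by simp
qed

definition ratio_sum :: "nat \<Rightarrow> real" where
  "ratio_sum n = (\<Sum>i\<le>n. l i / psum l i)"

text \<open>If L_n > 2 L_m, the terms with m < i <= n add at least (L_n - L_m) / L_n >= 1/2, because
  L_i <= L_n. Such blocks can be repeated without end.\<close>

lemma ratio_sum_unbounded:
  assumes div: "(\<Sum>n. ereal (l n)) = \<infinity>"
  shows "\<exists>n. K < ratio_sum n"
proof -
  have *: "\<exists>n. real k / 2 \<le> ratio_sum n" for k
  proof (induction k)
    case 0
    show ?case using l_nonneg psum_pos by (auto simp: ratio_sum_def intro!: exI sum_nonneg divide_nonneg_pos)
  next
    case (Suc k)
    then obtain m where m: "real k / 2 \<le> ratio_sum m" by blast
    obtain n where n: "2 * psum l m < psum l n" using psum_unbounded[OF div] by blast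
    have mn: "m \<le> n"
      using n psum_mono[of n m] psum_pos[of m] by (cases "m \<le> n") auto
    have "1 / 2 \<le> (psum l n - psum l m) / psum l n" using n psum_pos[of n] by (simp add: field_simps)
    also have "\<dots> = (\<Sum>i\<in>{m<..n}. l i / psum l n)"
      using sum_atMost_split[OF mn, of l] by (simp add: psum_def flip: sum_divide_distrib)
    also have "\<dots> \<le> (\<Sum>i\<in>{m<..n}. l i / psum l i)"
      using l_nonneg psum_pos psum_mono by (intro sum_mono divide_left_mono) auto
    also have "\<dots> = ratio_sum n - ratio_sum m"
      using sum_atMost_split[OF mn, of "\<lambda>i. l i / psum l i"] by (simp add: ratio_sum_def)
    finally show ?case using m by (intro exI[of _ n]) (simp add: field_simps)
  qed
  obtain k :: nat where "2 * K < real k" using reals_Archimedean2 by blast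
  then show ?thesis using *[of k] by (metis less_divide_eq_numeral1(1) less_le_trans mult.commute)
qed

text \<open>Since 0 need not belong to I, a truncated sequence is continued by elements of I so
  small that the weighted tail is dominated by a geometric series.\<close>

lemma summable_tail:
  obtains b where "\<And>n. b n \<in> I" "\<And>n. l n * b n \<le> (1 / 2) ^ n"
proof -
  have "\<exists>b\<in>I. l n * b \<le> (1 / 2) ^ n" for n
  proof -
    have "0 < (1 / 2) ^ n / (l n + 1)" using l_nonneg[of n] by simp
    then obtain b where b: "b \<in> I" "b < (1 / 2) ^ n / (l n + 1)" using small by blast
    have "l n * b \<le> (l n + 1) * b" using b nonneg by (auto simp: algebra_simps)
    also have "\<dots> \<le> (1 / 2) ^ n" using b l_nonneg[of n] by (simp add: pos_less_divide_eq mult.commute)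
    finally show ?thesis using b by blast
  qed
  then show ?thesis using that by metis
qed

text \<open>The Hardy inequality for y / L_n up to N, followed by the small tail; the summand 2
  bounds the geometric series. The real majorant c keeps the conclusion within the reals.\<close>

lemma hardy_bound_truncated:
  assumes bound: "hardy_bound I M l C" and y: "y \<in> C_domain" and c: "C \<le> ereal c" "0 \<le> c"
  shows "(\<Sum>n\<le>N. y * (l n / psum l n) * C_seq y n) \<le> c * (y * ratio_sum N + 2)"
proof -
  obtain b where b: "\<And>n. b n \<in> I" "\<And>n. l n * b n \<le> (1 / 2) ^ n" using summable_tail by blast
  have y': "0 < y" "\<And>n. y / psum l n \<in> I" using y by (auto simp: C_domain_def)
  define x where "x = (\<lambda>n. if n \<le> N then y / psum l n else b n)"
  have x: "x n \<in> I" for n using y' b by (simp add: x_def)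
  define S where "S = (\<Sum>n. ereal (l n * x n))"
  define T where "T = (\<Sum>n. ereal (l n * M (upto_term x n) (upto_term l n)))"
  have "S \<le> ereal (y * ratio_sum N + 2)"
    unfolding S_def
  proof (rule suminf_bound[OF allI])
    fix K
    have "(\<Sum>n<K. l n * x n) \<le> (\<Sum>n<K. (if n \<in> {..N} then y * (l n / psum l n) else 0) + (1 / 2) ^ n)"
      using b by (intro sum_mono) (auto simp: x_def mult.commute)
    also have "\<dots> = (\<Sum>n\<in>{..<K} \<inter> {..N}. y * (l n / psum l n)) + (\<Sum>n<K. (1 / 2) ^ n)"
      by (simp only: sum.distrib sum.inter_restrict[OF finite_lessThan])
    also have "(\<Sum>n\<in>{..<K} \<inter> {..N}. y * (l n / psum l n)) \<le> (\<Sum>n\<le>N. y * (l n / psum l n))"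
      using y'(1) l_nonneg psum_pos by (intro sum_mono2) (auto simp: less_imp_le)
    also have "\<dots> = y * ratio_sum N" by (simp add: ratio_sum_def sum_distrib_left)
    also have "(\<Sum>n<K. (1 / 2 :: real) ^ n) \<le> 2" by (simp add: sum_gp_strict)
    finally show "(\<Sum>n<K. ereal (l n * x n)) \<le> ereal (y * ratio_sum N + 2)" by simp
  qed (use term_nonneg(1)[OF x] in auto)
  moreover have "0 \<le> S" unfolding S_def using term_nonneg(1)[OF x] by (intro suminf_0_le) auto
  ultimately have "C * S \<le> ereal c * ereal (y * ratio_sum N + 2)"
    using c by (intro order_trans[OF ereal_mult_right_mono[OF c(1)] ereal_mult_left_mono]) auto
  moreover have "T \<le> C * S" using bound x unfolding hardy_bound_def S_def T_def by blast
  moreover have "ereal (\<Sum>n\<le>N. y * (l n / psum l n) * C_seq y n) \<le> T"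
  proof -
    have "upto_term x n = upto_term (\<lambda>k. y / psum l k) n" if "n \<le> N" for n
      using that by (auto simp: upto_term_def x_def)
    then have "(\<Sum>n\<le>N. y * (l n / psum l n) * C_seq y n)
        = (\<Sum>n\<le>N. l n * M (upto_term x n) (upto_term l n))"
      using y'(1) psum_pos by (intro sum.cong) (auto simp: C_seq_def less_imp_neq[THEN not_sym])
    also have "ereal \<dots> = (\<Sum>n<Suc N. ereal (l n * M (upto_term x n) (upto_term l n)))"
      by (simp add: lessThan_Suc_atMost)
    also have "\<dots> \<le> T"
      unfolding T_def using term_nonneg(2)[OF x] by (intro suminf_upper) auto
    finally show ?thesis .
  qed
  ultimately have "ereal (\<Sum>n\<le>N. y * (l n / psum l n) * C_seq y n) \<le> ereal c * ereal (y * ratio_sum N + 2)"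
    by order
  then show ?thesis by simp
qed

text \<open>If the lower limit exceeded C, two numbers d < c would fit between. The left side of
  \<open>hardy_bound_truncated\<close> would then grow at least like c y times
  \<open>ratio_sum N\<close>, the right side like d y times it, which fails for large N.\<close>

lemma C_constant_le:
  assumes div: "(\<Sum>n. ereal (l n)) = \<infinity>" and bound: "hardy_bound I M l C"
  shows "C_constant I M l \<le> C"
  unfolding C_constant_eq
proof (rule SUP_least, rule ccontr)
  fix y assume y: "y \<in> C_domain"
  let ?L = "liminf (\<lambda>n. ereal (C_seq y n))"
  assume "\<not> ?L \<le> C"
  moreover have "0 < ?L" using liminf_ge_1[OF y] by (rule less_le_trans[rotated]) simp
  \<comment> \<open>The maximum with 0 makes c and d positive reals even when C is negative or
    -\<infinity>.\<close>
  ultimately have "max C 0 < ?L" by simp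
  then obtain c where c: "max C 0 < ereal c" "ereal c < ?L" using ereal_dense2 by blast
  obtain d where d: "max C 0 < ereal d" "ereal d < ereal c" using ereal_dense2[OF c(1)] by blast
  have cd: "0 < d" "d < c" "C \<le> ereal d" using d by auto
  have y0: "0 < y" using y by (simp add: C_domain_def)
  obtain k where k: "\<And>n. k \<le> n \<Longrightarrow> c < C_seq y n"
    using less_LiminfD[OF c(2)] by (auto simp: eventually_sequentially)
  \<comment> \<open>The first entry of the maximum forces k <= N; the second is the final inequality
    solved for \<open>ratio_sum N\<close>.\<close>
  obtain N where N: "max (ratio_sum k) ((2 * d + y * c * ratio_sum k) / ((c - d) * y)) < ratio_sum N"
    using ratio_sum_unbounded[OF div] by blast
  have q: "0 \<le> y * (l n / psum l n)" for n using y0 l_nonneg psum_pos[of n] by simp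
  have kN: "k \<le> N"
  proof (rule ccontr)
    assume "\<not> k \<le> N"
    then have "ratio_sum N \<le> ratio_sum k"
      unfolding ratio_sum_def using l_nonneg psum_pos by (intro sum_mono2) (auto simp: less_imp_le)
    then show False using N by simp
  qed
  have "y * c * (ratio_sum N - ratio_sum k) = (\<Sum>n\<in>{k<..N}. y * (l n / psum l n) * c)"
    using sum_atMost_split[OF kN, of "\<lambda>i. l i / psum l i"]
    by (simp add: ratio_sum_def sum_distrib_left sum_distrib_right mult_ac)
  also have "\<dots> \<le> (\<Sum>n\<in>{k<..N}. y * (l n / psum l n) * C_seq y n)"
    using q k by (intro sum_mono mult_left_mono) (auto simp: less_imp_le)
  also have "\<dots> \<le> (\<Sum>n\<le>N. y * (l n / psum l n) * C_seq y n)"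
    by (intro sum_mono2 mult_nonneg_nonneg[OF q order_trans[OF zero_le_one C_seq_ge_1[OF y]]]) auto
  also have "\<dots> \<le> d * (y * ratio_sum N + 2)"
    using hardy_bound_truncated[OF bound y cd(3)] cd by simp
  finally have "(c - d) * y * ratio_sum N \<le> 2 * d + y * c * ratio_sum k" by (simp add: algebra_simps)
  moreover have "2 * d + y * c * ratio_sum k < (c - d) * y * ratio_sum N"
    using N cd y0 by (simp add: pos_divide_less_eq mult_ac)
  ultimately show False by linarith
qed

end

theorem corollary4p3:
  fixes I :: "real set" and M :: "real list \<Rightarrow> real list \<Rightarrow> real" and l :: "nat \<Rightarrow> real"
  assumes "is_interval I" and "I \<noteq> {}" and "bdd_below I" and "Inf I = 0"
    and "weighted_mean I M"
    and "symmetric_mean I M"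
    and "monotone_mean I M"
    and "jensen_concave_mean I M"
    and "continuous_in_weights I M"
    and "l \<in> V_weights"
  shows "hardy_constant I M l \<le> C_constant I M l \<and>
    ((\<Sum>n. ereal (l n)) = \<infinity> \<longrightarrow> hardy_constant I M l = C_constant I M l)"
proof -
  have nonneg: "I \<subseteq> {0..}" using assms(3,4) by (metis atLeast_iff cInf_lower subsetI)
  have small: "\<exists>b\<in>I. b < e" if "0 < e" for e
    using assms(2-4) that by (metis cInf_less_iff)
  interpret weighted_hardy_mean I M l
    by unfold_locales (use assms nonneg small in auto)
  have le: "hardy_constant I M l \<le> C_constant I M l"
    using hardy_bound_C_constant by (rule hardy_constant_le)
  moreover have "C_constant I M l \<le> hardy_constant I M l" if "(\<Sum>n. ereal (l n)) = \<infinity>"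
    unfolding hardy_constant_def using C_constant_le[OF that] by (intro Inf_greatest) auto
  ultimately show ?thesis by (auto intro: antisym)
qed

end
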